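(* Let $h\in(0,\frac1{4L}]$ and let $\rho,\rho'>0$ satisfy $\rho'/\rho\in(0,1)\cup\{1,2,3,\ldots\}$. Let $\alpha=(1+Lh)\frac\rho2$, $\kappa=2(1+Lh)\big(\frac{\alpha}{1-Lh}+\rho\big)$ and $\tilde\rho:=\min(\rho,\rho')$, and let $D=(D_0,D_1)\in\mathrm{bdc}_\rho$. Put $$D_{-1}:=\partial_\rho^{-1}(\mathrm{tr}_\rho^{-1}(D)),\qquad D_2:=\partial_\rho^2(\mathrm{tr}_\rho^{-1}(D)),$$ $$W_0^0:=\Phi^{\partial,\alpha+\kappa}_{h,\tilde\rho}(D_0)\cap\Phi^{\alpha}_{h,\tilde\rho}(D_0),\quad W_1:=\Phi^{\partial,\alpha}_{h,\tilde\rho}(D_1\cup D_2),\quad W_0^{-1}:=\Phi^{\partial,\alpha}_{h,\tilde\rho}(D_{-1}),$$ and let $\tilde D=(\tilde D_0,\tilde D_1)$ be given by $$\tilde D_1:=\{x\in W_1:\mathrm{dist}(x,W_0^0\cup W_0^{-1})=\tilde\rho\},\qquad \tilde D_0:=\{x\in W_0^0\cup W_0^{-1}:\mathrm{dist}(x,\tilde D_1)=\tilde\rho\}.$$ Then $$\Psi_{h,\rho,\rho'}(D)=\begin{cases}\tilde D,&\rho'\le\rho,\\ \partial R_{\tilde\rho}^{\rho'}(\tilde D),&\rho'>\rho.\end{cases}$$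
   Context: $\|\cdot\|_\infty$ is the max norm on $\mathbb{R}^d$, $B_r(x)$ the closed max-norm ball, $B_r(M)=\bigcup_{x\in M}B_r(x)$, and $\mathrm{dist}(x,M)=\inf_{y\in M}\|x-y\|_\infty$. For a set-valued map $G$ and a set $M$, $G(M):=\bigcup_{x\in M}G(x)$. Fixed throughout: constants $L,P>0$ and a map $F$ from $\mathbb{R}^d$ to the nonempty compact convex subsets of $\mathbb{R}^d$ which is $L$-Lipschitz with respect to the Hausdorff distance induced by $\|\cdot\|_\infty$ and satisfies $\|f\|_\infty\le P$ for all $f\in F(x)$, $x\in\mathbb{R}^d$. Grids: for $\rho>0$, $\Delta_\rho=\rho\mathbb{Z}^d$; $S_\rho$ is the set of nonempty subsets of $\Delta_\rho$, $S_\rho^+$ the set of all subsets of $\Delta_\rho$; $C_\rho$ is the set of all $M\in S_\rho$ such that for any $x,z\in M$ there is a finite sequence $y_0=x,\ldots,y_m=z$ in $M$ with $\|y_{i+1}-y_i\|_\infty=\rho$ for all $i$. Boundary layers: for $M\subset\Delta_\rho$, $\partial^0_\rho M:=\{x\in M:\exists z\in\Delta_\rho\setminus M,\ \|x-z\|_\infty=\rho\}$ and, for $j\ge1$, $\partial^j_\rho M:=\{x\in\Delta_\rho\setminus M:\mathrm{dist}(x,\partial^0_\rho M)=j\rho\}$, $\partial^{-j}_\rho M:=\{x\in M:\mathrm{dist}(x,\partial^0_\rho M)=j\rho\}$. The map $\mathrm{tr}_\rho:S_\rho\to S_\rho^+\times S_\rho^+$, $\mathrm{tr}_\rho(M):=(\partial^0_\rho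 M,\partial^1_\rho M)$, is injective (known); $\mathrm{bd}_\rho:=\mathrm{tr}_\rho(S_\rho)$, $\mathrm{bdc}_\rho:=\mathrm{tr}_\rho(C_\rho)$. For $\rho'/\rho\in\{2,3,\ldots\}$, $R_\rho^{\rho'}:S_\rho\to S_{\rho'}$, $R_\rho^{\rho'}(M):=B_{\rho'/2}(M)\cap\Delta_{\rho'}$, and $\partial R_\rho^{\rho'}:=\mathrm{tr}_{\rho'}\circ R_\rho^{\rho'}\circ\mathrm{tr}_\rho^{-1}:\mathrm{bd}_\rho\to\mathrm{bd}_{\rho'}$. Euler maps: $\pi^\alpha_\rho(M):=B_\alpha(M)\cap\Delta_\rho$; $\phi_h(x):=x+hF(x)$; $\Phi^\alpha_{h,\rho}(x):=\pi^\alpha_\rho(\phi_h(x))$; $\Phi^{\partial,\alpha}_{h,\rho}(x):=\pi^\alpha_\rho(\partial\phi_h(x))$, where $\partial\phi_h(x)$ is the topological boundary of $\phi_h(x)$ in $\mathbb{R}^d$. For $\rho'/\rho\in(0,1)\cup\{1,2,\ldots\}$ and $\alpha\ge\min(\rho,\rho')/2$, $\Phi^\alpha_{h,\rho,\rho'}(x):=R_\rho^{\rho'}(\Phi^\alpha_{h,\rho}(x))$ if $\rho<\rho'$, and $\Phi^\alpha_{h,\rho,\rho'}(x):=\Phi^\alpha_{h,\rho'}(x)$ if $\rho\ge\rho'$. Finally, with $\alpha(h,\rho):=(1+Lh)\frac\rho2$, $\Psi_{h,\rho,\rho'}:\mathrm{bdc}_\rho\to\mathrm{bdc}_{\rho'}$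 is $\Psi_{h,\rho,\rho'}:=\mathrm{tr}_{\rho'}\circ\Phi^{\alpha(h,\rho)}_{h,\rho,\rho'}\circ\mathrm{tr}_\rho^{-1}$. *)

theory Defs
  imports "HOL-Analysis.Analysis"
begin

text \<open>
  The space is \<open>real ^ 'd\<close>; the max norm is the library's \<^const>\<open>infnorm\<close>. The library's
  \<open>cball\<close>, \<open>infdist\<close>, \<open>setdist\<close> refer to the Euclidean norm, so their max-norm
  counterparts are introduced here.
\<close>

definition max_ball :: "real \<Rightarrow> real ^ 'd \<Rightarrow> (real ^ 'd) set" where
  "max_ball r x = {y. infnorm (y - x) \<le> r}"

definition nbhd :: "real \<Rightarrow> (real ^ 'd) set \<Rightarrow> (real ^ 'd) set" where
  "nbhd r M = (\<Union>x\<in>M. max_ball r x)"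

text \<open>
  Distances are extended reals so that the infimum over the empty set is \<open>\<infinity>\<close>: boundary layers
  may be empty (for instance, those of the whole grid), and then no point lies at a finite
  distance from them.
\<close>

definition max_dist :: "real ^ 'd \<Rightarrow> (real ^ 'd) set \<Rightarrow> ereal" where
  "max_dist x M = (INF y\<in>M. ereal (infnorm (x - y)))"

definition max_hausdorff :: "(real ^ 'd) set \<Rightarrow> (real ^ 'd) set \<Rightarrow> ereal" where
  "max_hausdorff A B = max (SUP a\<in>A. max_dist a B) (SUP b\<in>B. max_dist b A)"

definition grid :: "real \<Rightarrow> (real ^ 'd) set" where
  "grid \<rho> = {x. \<forall>i. \<exists>k::int. x $ i = \<rho> * of_int k}"

definition grid_sets :: "real \<Rightarrow> (real ^ 'd) set set" where
  "grid_sets \<rho> = {M. M \<noteq> {} \<and> M \<subseteq> grid \<rho>}"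

definition chain_connected_sets :: "real \<Rightarrow> (real ^ 'd) set set" where
  "chain_connected_sets \<rho> = {M \<in> grid_sets \<rho>. \<forall>x\<in>M. \<forall>z\<in>M.
     \<exists>(m::nat) y. y 0 = x \<and> y m = z \<and> (\<forall>i\<le>m. y i \<in> M) \<and>
       (\<forall>i<m. infnorm (y (Suc i) - y i) = \<rho>)}"

definition boundary0 :: "real \<Rightarrow> (real ^ 'd) set \<Rightarrow> (real ^ 'd) set" where
  "boundary0 \<rho> M = {x \<in> M. \<exists>z \<in> grid \<rho> - M. infnorm (x - z) = \<rho>}"

text \<open>
  The layer of integer index \<open>j\<close>: outside \<open>M\<close> for \<open>j > 0\<close>, inside \<open>M\<close> for \<open>j < 0\<close>.
\<close>

definition boundary_layer :: "real \<Rightarrow> int \<Rightarrow> (real ^ 'd) set \<Rightarrow> (real ^ 'd) set" where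
  "boundary_layer \<rho> j M =
     (if j = 0 then boundary0 \<rho> M
      else if j > 0 then {x \<in> grid \<rho> - M. max_dist x (boundary0 \<rho> M) = ereal (of_int j * \<rho>)}
      else {x \<in> M. max_dist x (boundary0 \<rho> M) = ereal (of_int (- j) * \<rho>)})"

definition tr :: "real \<Rightarrow> (real ^ 'd) set \<Rightarrow> (real ^ 'd) set \<times> (real ^ 'd) set" where
  "tr \<rho> M = (boundary_layer \<rho> 0 M, boundary_layer \<rho> 1 M)"

definition bd :: "real \<Rightarrow> ((real ^ 'd) set \<times> (real ^ 'd) set) set" where
  "bd \<rho> = tr \<rho> ` grid_sets \<rho>"

definition bdc :: "real \<Rightarrow> ((real ^ 'd) set \<times> (real ^ 'd) set) set" where
  "bdc \<rho> = tr \<rho> ` chain_connected_sets \<rho>"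

text \<open>
  \<^term>\<open>tr \<rho>\<close> is injective on \<^term>\<open>grid_sets \<rho>\<close> for \<open>\<rho> > 0\<close>, so this is its inverse on
  \<^term>\<open>bd \<rho>\<close>; outside \<^term>\<open>bd \<rho>\<close> it is meaningless.
\<close>

definition tr_inv :: "real \<Rightarrow> (real ^ 'd) set \<times> (real ^ 'd) set \<Rightarrow> (real ^ 'd) set" where
  "tr_inv \<rho> = inv_into (grid_sets \<rho>) (tr \<rho>)"

definition proj :: "real \<Rightarrow> real \<Rightarrow> (real ^ 'd) set \<Rightarrow> (real ^ 'd) set" where
  "proj \<alpha> \<rho> M = nbhd \<alpha> M \<inter> grid \<rho>"

text \<open>
  The grid change map from \<open>\<rho>\<close> to \<open>\<rho>'\<close>; the spacing \<open>\<rho>\<close> only determines its domain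
  \<^term>\<open>grid_sets \<rho>\<close> and is therefore not an argument.
\<close>

definition regrid :: "real \<Rightarrow> (real ^ 'd) set \<Rightarrow> (real ^ 'd) set" where
  "regrid \<rho>' M = nbhd (\<rho>' / 2) M \<inter> grid \<rho>'"

definition bd_regrid ::
  "real \<Rightarrow> real \<Rightarrow> (real ^ 'd) set \<times> (real ^ 'd) set \<Rightarrow> (real ^ 'd) set \<times> (real ^ 'd) set" where
  "bd_regrid \<rho> \<rho>' = tr \<rho>' \<circ> regrid \<rho>' \<circ> tr_inv \<rho>"

definition set_image :: "('a \<Rightarrow> 'b set) \<Rightarrow> 'a set \<Rightarrow> 'b set" where
  "set_image G M = (\<Union>x\<in>M. G x)"

definition euler :: "(real ^ 'd \<Rightarrow> (real ^ 'd) set) \<Rightarrow> real \<Rightarrow> real ^ 'd \<Rightarrow> (real ^ 'd) set" where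
  "euler F h x = {x + h *\<^sub>R f | f. f \<in> F x}"

definition Phi ::
  "(real ^ 'd \<Rightarrow> (real ^ 'd) set) \<Rightarrow> real \<Rightarrow> real \<Rightarrow> real \<Rightarrow> real ^ 'd \<Rightarrow> (real ^ 'd) set" where
  "Phi F \<alpha> h \<rho> x = proj \<alpha> \<rho> (euler F h x)"

definition Phi_bd ::
  "(real ^ 'd \<Rightarrow> (real ^ 'd) set) \<Rightarrow> real \<Rightarrow> real \<Rightarrow> real \<Rightarrow> real ^ 'd \<Rightarrow> (real ^ 'd) set" where
  "Phi_bd F \<alpha> h \<rho> x = proj \<alpha> \<rho> (frontier (euler F h x))"

definition Phi_regrid ::
  "(real ^ 'd \<Rightarrow> (real ^ 'd) set) \<Rightarrow> real \<Rightarrow> real \<Rightarrow> real \<Rightarrow> real \<Rightarrow> real ^ 'd \<Rightarrow> (real ^ 'd) set" where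
  "Phi_regrid F \<alpha> h \<rho> \<rho>' x =
     (if \<rho> < \<rho>' then regrid \<rho>' (Phi F \<alpha> h \<rho> x) else Phi F \<alpha> h \<rho>' x)"

definition blow_up :: "real \<Rightarrow> real \<Rightarrow> real \<Rightarrow> real" where
  "blow_up L h \<rho> = (1 + L * h) * (\<rho> / 2)"

text \<open>
  \<^term>\<open>Psi F L h \<rho> \<rho>'\<close> is only meaningful on \<^term>\<open>bdc \<rho>\<close>.
\<close>

definition Psi ::
  "(real ^ 'd \<Rightarrow> (real ^ 'd) set) \<Rightarrow> real \<Rightarrow> real \<Rightarrow> real \<Rightarrow> real \<Rightarrow>
   (real ^ 'd) set \<times> (real ^ 'd) set \<Rightarrow> (real ^ 'd) set \<times> (real ^ 'd) set" where
  "Psi F L h \<rho> \<rho>' =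
     tr \<rho>' \<circ> set_image (Phi_regrid F (blow_up L h \<rho>) h \<rho> \<rho>') \<circ> tr_inv \<rho>"

end

theory Submission
  imports Defs
begin

text \<open>
  Write \<open>\<phi> x = x + h F(x)\<close> and let \<open>N\<close> be the image of \<open>M = tr_inv \<rho> D\<close> under the Euler map on the
  grid of width \<open>\<tau>\<close>. For fixed \<open>z\<close> the map \<open>y \<mapsto> z - h F(y)\<close> is a convex-valued contraction with
  constant \<open>L h \<le> 1/4\<close>. Hence an approximate solution of \<open>z \<in> \<phi> y\<close> has a solution nearby, and the
  solution set cannot be split: two solutions are joined by chains of solutions with arbitrarily
  small steps. If \<open>z \<in> N\<close> and \<open>z' \<notin> N\<close> are grid neighbours, then \<open>z'\<close> is hit from outside \<open>M\<close> by a
  point at most \<open>2 \<rho>\<close> away from any point of \<open>M\<close> hitting \<open>z\<close>, which confines both to the layers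
  \<open>-1, 0, 1, 2\<close>; cancellation of balls in \<open>B + C \<subseteq> B + A\<close> with \<open>A\<close> convex shows that the hits
  already come from the frontiers. So the two layers of \<open>N\<close> are covered by the sets \<open>W\<close>. Conversely, a
  point of \<open>N\<close> in \<open>W1\<close> is hit from inside and outside \<open>M\<close>, so chaining solutions shows that it is
  also hit from \<open>D0\<close>, and \<open>\<kappa>\<close> is large enough for it to lie in \<open>W00\<close>.
\<close>

section \<open>Max norm, its balls and neighbourhoods\<close>

lemma infnorm_attained: "\<exists>i. infnorm x = \<bar>x $ i\<bar>" for x :: "real ^ 'd"
proof -
  have eq: "{\<bar>x $ i\<bar> | i. i \<in> UNIV} = range (\<lambda>i. \<bar>x $ i\<bar>)" by auto
  have "infnorm x = Max (range (\<lambda>i. \<bar>x $ i\<bar>))"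
    unfolding infnorm_cart eq by (intro cSup_eq_Max) auto
  moreover have "Max (range (\<lambda>i. \<bar>x $ i\<bar>)) \<in> range (\<lambda>i. \<bar>x $ i\<bar>)"
    by (intro Max_in) auto
  ultimately have "infnorm x \<in> range (\<lambda>i. \<bar>x $ i\<bar>)" by simp
  then show ?thesis by (rule rangeE) blast
qed

lemma infnorm_le_cart_iff: "infnorm x \<le> c \<longleftrightarrow> (\<forall>i. \<bar>x $ i\<bar> \<le> c)" for x :: "real ^ 'd"
proof
  show "infnorm x \<le> c \<Longrightarrow> \<forall>i. \<bar>x $ i\<bar> \<le> c"
    using order_trans[OF component_le_infnorm_cart[of x]] by blast
  show "\<forall>i. \<bar>x $ i\<bar> \<le> c \<Longrightarrow> infnorm x \<le> c"
    using infnorm_attained[of x] by auto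
qed

lemma infnorm_triangle3: "infnorm (x - z) \<le> infnorm (x - y) + infnorm (y - z)"
  using infnorm_triangle[of "x - y" "y - z"] by simp

lemma mem_max_ball: "y \<in> max_ball r x \<longleftrightarrow> infnorm (y - x) \<le> r"
  by (simp add: max_ball_def)

lemma mem_nbhd: "z \<in> nbhd r A \<longleftrightarrow> (\<exists>p\<in>A. infnorm (z - p) \<le> r)"
  by (auto simp: nbhd_def max_ball_def)

lemma nbhdI: "p \<in> A \<Longrightarrow> infnorm (z - p) \<le> r \<Longrightarrow> z \<in> nbhd r A"
  by (auto simp: mem_nbhd)

lemma nbhd_triangle:
  assumes "z \<in> nbhd r A" "infnorm (z' - z) \<le> s" "r + s \<le> t"
  shows "z' \<in> nbhd t A"
proof -
  obtain p where "p \<in> A" "infnorm (z - p) \<le> r" using assms(1) by (auto simp: mem_nbhd)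
  then show ?thesis using assms(2,3) infnorm_triangle3[of z' p z] by (intro nbhdI) auto
qed

lemma nbhd_nbhd: "A \<subseteq> nbhd s B \<Longrightarrow> nbhd r A \<subseteq> nbhd (r + s) B"
proof
  fix z assume "A \<subseteq> nbhd s B" "z \<in> nbhd r A"
  then obtain p where "p \<in> nbhd s B" "infnorm (z - p) \<le> r" by (auto simp: mem_nbhd)
  then show "z \<in> nbhd (r + s) B" by (rule nbhd_triangle) simp
qed

lemma compact_max_ball: "compact (max_ball r x :: (real ^ 'd) set)"
proof -
  have "closed (max_ball r x)"
    unfolding max_ball_def
    by (intro closed_Collect_le continuous_intros continuous_on_infnorm)
  moreover have "norm (y - x) \<le> sqrt DIM(real ^ 'd) * r" if "infnorm (y - x) \<le> r" for y
  proof -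
    have "norm (y - x) \<le> sqrt DIM(real ^ 'd) * infnorm (y - x)" by (rule norm_le_infnorm)
    also have "\<dots> \<le> sqrt DIM(real ^ 'd) * r" using that by (intro mult_left_mono) auto
    finally show ?thesis .
  qed
  then have "max_ball r x \<subseteq> cball x (sqrt DIM(real ^ 'd) * r)"
    by (auto simp: mem_max_ball mem_cball dist_norm norm_minus_commute)
  then have "bounded (max_ball r x)" using bounded_cball bounded_subset by blast
  ultimately show ?thesis by (simp add: compact_eq_bounded_closed)
qed

lemma convex_max_ball: "convex (max_ball r x)"
proof (rule convexI)
  fix u v :: real and a b assume *: "a \<in> max_ball r x" "b \<in> max_ball r x" "0 \<le> u" "0 \<le> v" "u + v = 1"
  have "u *\<^sub>R a + v *\<^sub>R b - x = u *\<^sub>R (a - x) + v *\<^sub>R (b - x)"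
    using scaleR_left_distrib[of u v x] *(5) by (simp add: algebra_simps)
  then have "infnorm (u *\<^sub>R a + v *\<^sub>R b - x) \<le> u * infnorm (a - x) + v * infnorm (b - x)"
    using infnorm_triangle[of "u *\<^sub>R (a - x)" "v *\<^sub>R (b - x)"] *(3,4) by (simp add: infnorm_mul)
  also have "\<dots> \<le> r" 
    using * by (intro convex_bound_le) (auto simp: mem_max_ball)
  finally show "u *\<^sub>R a + v *\<^sub>R b \<in> max_ball r x" by (simp add: mem_max_ball)
qed

section \<open>Cancellation of balls and frontiers of convex sets\<close>

lemma nbhd_eq_sums: "nbhd d A = (\<Union>p\<in>A. \<Union>v\<in>max_ball d 0. {p + v})"
proof safe
  fix z assume "z \<in> nbhd d A"
  then obtain p where "p \<in> A" "infnorm (z - p) \<le> d" by (auto simp: mem_nbhd)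
  then have "z - p \<in> max_ball d 0" "z \<in> {p + (z - p)}" by (auto simp: mem_max_ball)
  then show "z \<in> (\<Union>p\<in>A. \<Union>v\<in>max_ball d 0. {p + v})" using \<open>p \<in> A\<close> by blast
qed (auto simp: mem_max_ball intro!: nbhdI)

text \<open>Radstroem's cancellation law for balls. A point outside the closed convex set
  \<open>nbhd d A\<close> is strictly separated from it by a linear functional; adding to
  \<open>q\<close> the vector of the \<open>r\<close>-ball that minimises this functional leads out
  of \<open>nbhd (r + d) A\<close>.\<close>

lemma Radstroem_cancellation:
  fixes A :: "(real ^ 'd) set"
  assumes A: "compact A" "convex A" and "0 \<le> r" "0 \<le> d"
    and sub: "max_ball r q \<subseteq> nbhd (r + d) A"
  shows "q \<in> nbhd d A"
proof (rule ccontr)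
  assume q: "q \<notin> nbhd d A"
  have "closed (nbhd d A)" unfolding nbhd_eq_sums
    by (intro compact_imp_closed compact_sums' A compact_max_ball)
  moreover have "convex (nbhd d A)" unfolding nbhd_eq_sums
    by (intro convex_sums A convex_max_ball)
  ultimately obtain a b where ab: "a \<bullet> q < b" "\<And>x. x \<in> nbhd d A \<Longrightarrow> b < a \<bullet> x"
    using separating_hyperplane_closed_point[OF _ _ q] by blast
  have "(0::real ^ 'd) \<in> max_ball r 0" using \<open>0 \<le> r\<close> by (simp add: mem_max_ball infnorm_0)
  moreover have "continuous_on (max_ball r 0) (\<lambda>w. a \<bullet> w)" by (intro continuous_intros)
  ultimately obtain v where v: "v \<in> max_ball r 0" "\<And>w. w \<in> max_ball r 0 \<Longrightarrow> a \<bullet> v \<le> a \<bullet> w"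
    using continuous_attains_inf[OF compact_max_ball, of r 0 "\<lambda>w. a \<bullet> w"] by blast
  have "q + v \<in> nbhd (r + d) A" using sub v(1) by (auto simp: mem_max_ball)
  then obtain p where p: "p \<in> A" "infnorm (q + v - p) \<le> r + d" by (auto simp: mem_nbhd)
  define w where "w = q + v - p"
  \<comment> \<open>Split \<open>w\<close> in proportion to the radii: \<open>t *\<^sub>R w\<close>
    has norm at most \<open>r\<close>, the rest at most \<open>d\<close>. If both radii vanish, so
    does \<open>w\<close>.\<close>
  define t where "t = (if r + d = 0 then 0 else r / (r + d))"
  have t: "0 \<le> t" "t \<le> 1" "t * (r + d) = r"
    using \<open>0 \<le> r\<close> \<open>0 \<le> d\<close> by (auto simp: t_def)
  then have t': "(1 - t) * (r + d) = d" by (simp add: left_diff_distrib)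
  have w: "infnorm w \<le> r + d" using p by (simp add: w_def)
  have "t *\<^sub>R w \<in> max_ball r 0"
    using mult_left_mono[OF w t(1)] t by (simp add: mem_max_ball infnorm_mul)
  moreover have "p + (1 - t) *\<^sub>R w \<in> nbhd d A"
    using p(1) mult_left_mono[OF w, of "1 - t"] t t'
    by (intro nbhdI[of p]) (auto simp: infnorm_mul)
  ultimately have "a \<bullet> v \<le> a \<bullet> (t *\<^sub>R w)" "b < a \<bullet> (p + (1 - t) *\<^sub>R w)"
    using v(2) ab(2) by blast+
  moreover have "q + v = (p + (1 - t) *\<^sub>R w) + t *\<^sub>R w"
    by (simp add: w_def algebra_simps)
  then have "a \<bullet> q + a \<bullet> v = a \<bullet> (p + (1 - t) *\<^sub>R w) + a \<bullet> (t *\<^sub>R w)"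
    by (metis inner_add_right)
  ultimately show False using ab(1) by linarith
qed

text \<open>A connected ball that meets \<open>A\<close> but not its frontier cannot leave
  \<open>A\<close>. Later this turns failure to be near the frontier into a whole ball inside an
  Euler image.\<close>

lemma max_ball_subset_if_frontier_far:
  fixes A :: "(real ^ 'd) set"
  assumes "z \<in> nbhd r A" "z \<notin> nbhd r (frontier A)"
  shows "max_ball r z \<subseteq> A"
proof -
  have "connected (max_ball r z)" by (intro convex_connected convex_max_ball)
  moreover have "max_ball r z \<inter> A \<noteq> {}" "max_ball r z \<inter> frontier A = {}"
    using assms infnorm_sub[of z] by (auto simp: mem_nbhd mem_max_ball)
  ultimately show ?thesis using connected_Int_frontier by blast
qed

text \<open>If a frontier point \<open>p\<close> of \<open>A\<close> were farther than
  \<open>k\<close> from the frontier of \<open>B\<close>, the \<open>k\<close>-ball at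
  \<open>p\<close> would lie in \<open>B\<close>, hence within \<open>e\<close> of \<open>A\<close>.
  Cancelling \<open>e\<close> leaves a ball of radius \<open>k - e > 0\<close> inside
  \<open>A\<close>, so \<open>p\<close> would be interior.\<close>

lemma nbhd_frontier_transfer:
  fixes A B :: "(real ^ 'd) set"
  assumes A: "compact A" "convex A"
    and AB: "A \<subseteq> nbhd e B" and BA: "B \<subseteq> nbhd e A" and "0 \<le> e" "e < k"
  shows "nbhd r (frontier A) \<subseteq> nbhd (r + k) (frontier B)"
proof (rule nbhd_nbhd, rule ccontr)
  assume "\<not> frontier A \<subseteq> nbhd k (frontier B)"
  then obtain p where p: "p \<in> frontier A" "p \<notin> nbhd k (frontier B)" by blast
  have "p \<in> A" using p frontier_subset_closed[OF compact_imp_closed[OF A(1)]] by blast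
  then have "p \<in> nbhd k B" using AB \<open>e < k\<close> by (force intro: nbhd_triangle[of p e B p] simp: infnorm_0)
  then have sub: "max_ball k p \<subseteq> B" by (rule max_ball_subset_if_frontier_far[OF _ p(2)])
  have near: "q \<in> A" if q: "infnorm (q - p) \<le> k - e" for q
  proof -
    have "max_ball e q \<subseteq> max_ball k p"
      
    proof
      fix y assume "y \<in> max_ball e q"
      then show "y \<in> max_ball k p"
        using q infnorm_triangle3[of y p q] by (simp add: mem_max_ball)
    qed
    then have "q \<in> nbhd 0 A"
      using sub BA \<open>0 \<le> e\<close> A by (intro Radstroem_cancellation[of A e 0]) auto
    then obtain p' where "p' \<in> A" "infnorm (q - p') \<le> 0" by (auto simp: mem_nbhd)
    then show ?thesis using infnorm_pos_lt[of "q - p'"] by force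
  qed
  \<comment> \<open>The interior is taken with Euclidean balls, which lie in the max-norm balls of
    the same radius.\<close>
  have "ball p (k - e) \<subseteq> A"

  proof
    fix q assume "q \<in> ball p (k - e)"
    then have "norm (q - p) < k - e" by (simp add: dist_norm norm_minus_commute)
    then show "q \<in> A" using infnorm_le_norm[of "q - p"] near[of q] by linarith
  qed
  then have "p \<in> interior A" using \<open>e < k\<close> by (auto simp: mem_interior intro!: exI[of _ "k - e"])
  then show False using p(1) by (simp add: frontier_def)
qed

section \<open>Geometry of the grid\<close>

lemma mem_grid: "x \<in> grid \<rho> \<longleftrightarrow> (\<exists>k. \<forall>i. x $ i = \<rho> * of_int (k i))"
  by (auto simp: grid_def choice_iff)

lemma grid_infnorm_multiple:
  assumes "0 < \<rho>" "x \<in> grid \<rho>" "y \<in> grid \<rho>"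
  obtains n :: nat where "infnorm (x - y) = \<rho> * real n"
proof -
  obtain i where i: "infnorm (x - y) = \<bar>x $ i - y $ i\<bar>"
    using infnorm_attained[of "x - y"] by auto
  obtain k l :: int where "x $ i = \<rho> * of_int k" "y $ i = \<rho> * of_int l"
    using assms(2,3) unfolding grid_def by blast
  then have "x $ i - y $ i = \<rho> * of_int (k - l)" by (simp add: algebra_simps)
  then have "infnorm (x - y) = \<rho> * real (nat \<bar>k - l\<bar>)"
    using \<open>0 < \<rho>\<close> by (simp add: i abs_mult del: of_int_diff)
  then show ?thesis by (rule that)
qed

text \<open>Distances on the grid are multiples of \<rho>, so a strict bound drops to the next lower
  multiple. Real estimates such as \<open>< 3 * \<rho>\<close> thereby become step counts.\<close>

lemma grid_infnorm_le:
  assumes "0 < \<rho>" "x \<in> grid \<rho>" "y \<in> grid \<rho>" "infnorm (x - y) < (real n + 1) * \<rho>"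
  shows "infnorm (x - y) \<le> real n * \<rho>"
proof -
  obtain m where m: "infnorm (x - y) = \<rho> * real m"
    using grid_infnorm_multiple[OF assms(1-3)] .
  then have "real m < real n + 1" using assms(1,4) by (simp add: mult.commute)
  then have "m \<le> n" by linarith
  then show ?thesis using m assms(1) by (simp add: mult.commute mult_left_mono)
qed

lemma grid_infnorm_ge:
  assumes "0 < \<rho>" "x \<in> grid \<rho>" "y \<in> grid \<rho>" "x \<noteq> y"
  shows "\<rho> \<le> infnorm (x - y)"
  using grid_infnorm_le[OF assms(1-3), of 0] infnorm_pos_lt[of "x - y"] assms(4) by force

lemma grid_nearest:
  assumes "0 < \<rho>"
  obtains x where "x \<in> grid \<rho>" "infnorm (x - y) \<le> \<rho> / 2"
proof
  let ?x = "\<chi> i. \<rho> * of_int (round (y $ i / \<rho>))"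
  show "?x \<in> grid \<rho>" by (auto simp: grid_def)
  have "\<bar>\<rho> * of_int (round (y $ i / \<rho>)) - y $ i\<bar> \<le> \<rho> / 2" for i
  proof -
    have "\<rho> * of_int (round (y $ i / \<rho>)) - y $ i = \<rho> * (of_int (round (y $ i / \<rho>)) - y $ i / \<rho>)"
      using assms by (simp add: algebra_simps)
    also have "\<bar>\<dots>\<bar> \<le> \<rho> * (1 / 2)"
      unfolding abs_mult using assms of_int_round_abs_le[of "y $ i / \<rho>"] by (intro mult_mono) auto
    finally show ?thesis by simp
  qed
  then show "infnorm (?x - y) \<le> \<rho> / 2" unfolding infnorm_le_cart_iff by simp
qed

lemma grid_step_towards:
  assumes "0 < \<rho>" "x \<in> grid \<rho>" "y \<in> grid \<rho>" "infnorm (x - y) \<le> real (Suc n) * \<rho>"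
  obtains m where "m \<in> grid \<rho>" "infnorm (x - m) \<le> real n * \<rho>" "infnorm (m - y) \<le> \<rho>"
proof -
  obtain k l where k: "\<And>i. x $ i = \<rho> * of_int (k i)" and l: "\<And>i. y $ i = \<rho> * of_int (l i)"
    using assms(2,3) unfolding mem_grid by blast
  \<comment> \<open>Each coordinate of \<open>y\<close> that differs from that of \<open>x\<close>
    moves one unit towards it; in the max norm all of them may move in the same step.\<close>
  let ?m = "\<chi> i. \<rho> * of_int (l i + sgn (k i - l i))"
  have "\<bar>k i - l i\<bar> \<le> 1 + int n" for i
  proof -
    have "\<rho> * of_int \<bar>k i - l i\<bar> = \<bar>(x - y) $ i\<bar>"
      using assms(1) by (simp add: k l abs_mult flip: right_diff_distrib)
    also have "\<dots> \<le> \<rho> * of_int (1 + int n)"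
      using assms(4) infnorm_le_cart_iff[of "x - y"] by (simp add: mult.commute)
    finally show ?thesis using assms(1) by (simp only: mult_le_cancel_left_pos of_int_le_iff)
  qed
  then have int: "\<bar>k i - (l i + sgn (k i - l i))\<bar> \<le> int n" for i
    by (smt (verit, best) of_nat_0_le_iff sgn_if)
  have "\<bar>\<rho> * of_int (k i) - \<rho> * of_int (l i + sgn (k i - l i))\<bar> \<le> real n * \<rho>" for i
  proof -
    have "\<bar>\<rho> * of_int (k i) - \<rho> * of_int (l i + sgn (k i - l i))\<bar>
        = \<rho> * of_int \<bar>k i - (l i + sgn (k i - l i))\<bar>"
      using assms(1) by (simp add: abs_mult flip: right_diff_distrib)
    also have "\<dots> \<le> \<rho> * of_int (int n)"
      using assms(1) int[of i] by (intro mult_left_mono) (auto simp only: of_int_le_iff)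
    finally show ?thesis by (simp add: mult.commute)
  qed
  then have "infnorm (x - ?m) \<le> real n * \<rho>" by (simp add: infnorm_le_cart_iff k)
  moreover have "\<bar>\<rho> * of_int (l i + sgn (k i - l i)) - \<rho> * of_int (l i)\<bar> \<le> \<rho>" for i
    using assms(1) by (auto simp: sgn_if algebra_simps)
  then have "infnorm (?m - y) \<le> \<rho>" by (simp add: infnorm_le_cart_iff l)
  moreover have "?m \<in> grid \<rho>" unfolding grid_def by (simp del: of_int_add)
  ultimately show ?thesis using that by blast
qed

text \<open>The infimum is attained because distances are multiples of \<rho>: a point less than
  \<rho> above the infimum has no strictly closer rival, since that one would undercut the infimum.
  For empty \<open>S\<close> both sides fail.\<close>

lemma max_dist_eq_grid_iff:
  assumes "0 < \<rho>" "x \<in> grid \<rho>" "S \<subseteq> grid \<rho>"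
  shows "max_dist x S = ereal c \<longleftrightarrow>
    (\<exists>y\<in>S. infnorm (x - y) = c) \<and> (\<forall>y\<in>S. c \<le> infnorm (x - y))"
proof (intro iffI conjI)
  assume eq: "max_dist x S = ereal c"
  then show ge: "\<forall>y\<in>S. c \<le> infnorm (x - y)"
    unfolding max_dist_def by (metis INF_lower ereal_less_eq(3))
  have "max_dist x S < ereal (c + \<rho>)" using eq assms(1) by simp
  then obtain y where y: "y \<in> S" "infnorm (x - y) < c + \<rho>"
    unfolding max_dist_def INF_less_iff by auto
  have "y' \<in> S \<Longrightarrow> infnorm (x - y) \<le> infnorm (x - y')" if "infnorm (x - y) \<noteq> c" for y'
  proof (rule ccontr)
    assume "y' \<in> S" and less: "\<not> infnorm (x - y) \<le> infnorm (x - y')"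
    obtain n m where "infnorm (x - y) = \<rho> * real n" "infnorm (x - y') = \<rho> * real m"
      using grid_infnorm_multiple[OF assms(1,2)] assms(3) y(1) \<open>y' \<in> S\<close> by (metis subsetD)
    moreover from this less have "m + 1 \<le> n" using assms(1) by (simp add: not_le)
    then have "\<rho> * (real m + 1) \<le> \<rho> * real n" using assms(1) by (intro mult_left_mono) auto
    ultimately have "infnorm (x - y') + \<rho> \<le> infnorm (x - y)" by (simp add: algebra_simps)
    then show False using y(2) ge \<open>y' \<in> S\<close> by force
  qed
  then have "infnorm (x - y) \<noteq> c \<Longrightarrow> ereal (infnorm (x - y)) \<le> max_dist x S"
    unfolding max_dist_def by (auto intro!: INF_greatest)
  then show "\<exists>y\<in>S. infnorm (x - y) = c" using eq y(1) ge by force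
next
  assume *: "(\<exists>y\<in>S. infnorm (x - y) = c) \<and> (\<forall>y\<in>S. c \<le> infnorm (x - y))"
  then obtain y where "y \<in> S" "infnorm (x - y) = c" by blast
  then show "max_dist x S = ereal c"
    unfolding max_dist_def using * by (intro antisym) (auto intro!: INF_greatest intro: INF_lower2)
qed

section \<open>Boundary layers and injectivity of \<open>tr\<close>\<close>

lemma boundary0_subset_grid: "M \<subseteq> grid \<rho> \<Longrightarrow> boundary0 \<rho> M \<subseteq> grid \<rho>"
  by (auto simp: boundary0_def)

lemma boundary0I:
  assumes "0 < \<rho>" "M \<subseteq> grid \<rho>" "x \<in> M" "z \<in> grid \<rho> - M" "infnorm (x - z) < 2 * \<rho>"
  shows "x \<in> boundary0 \<rho> M" "infnorm (x - z) = \<rho>"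
proof -
  have "infnorm (x - z) \<le> \<rho>" 
    using grid_infnorm_le[of \<rho> x z 1] assms by auto
  moreover have "\<rho> \<le> infnorm (x - z)" using grid_infnorm_ge[of \<rho> x z] assms by blast
  ultimately show "infnorm (x - z) = \<rho>" by simp
  then show "x \<in> boundary0 \<rho> M" using assms by (auto simp: boundary0_def)
qed

text \<open>A member of \<open>M\<close> at distance \<rho> from an outside grid point belongs to
  \<open>boundary0 \<rho> M\<close> anyway, so the distance may be measured to \<open>M\<close>
  itself.\<close>

lemma boundary_layer_1_iff:
  assumes "0 < \<rho>" "M \<subseteq> grid \<rho>"
  shows "z \<in> boundary_layer \<rho> 1 M \<longleftrightarrow> z \<in> grid \<rho> - M \<and> (\<exists>x\<in>M. infnorm (x - z) = \<rho>)"
proof (cases "z \<in> grid \<rho> - M")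
  case True
  have "max_dist z (boundary0 \<rho> M) = ereal \<rho> \<longleftrightarrow> (\<exists>x\<in>M. infnorm (x - z) = \<rho>)"
    unfolding max_dist_eq_grid_iff[OF assms(1) DiffD1[OF True] boundary0_subset_grid[OF assms(2)]]
    using True assms grid_infnorm_ge[of \<rho> z] infnorm_sub[of z]
    by (force simp: boundary0_def)
  then show ?thesis using True by (simp add: boundary_layer_def)
qed (auto simp: boundary_layer_def)

text \<open>The points are at most two grid steps apart; let \<open>m\<close> lie between them. If
  \<open>m\<close> is outside \<open>M\<close>, then \<open>x\<close> is in layer 0. Otherwise
  \<open>m\<close> is in layer 0 because of \<open>x'\<close>, and \<open>x\<close> is within one
  step of it.\<close>

lemma mem_inner_layers:
  assumes "0 < \<rho>" "M \<subseteq> grid \<rho>" "x \<in> M" "x' \<in> grid \<rho> - M" "infnorm (x - x') < 3 * \<rho>"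
  shows "x \<in> boundary0 \<rho> M \<union> boundary_layer \<rho> (-1) M"
proof -
  have "infnorm (x' - x) \<le> real (Suc 1) * \<rho>"
    using grid_infnorm_le[of \<rho> x' x 2] assms infnorm_sub[of x'] by auto
  then obtain m where m: "m \<in> grid \<rho>" "infnorm (x' - m) \<le> \<rho>" "infnorm (m - x) \<le> \<rho>"
    using grid_step_towards[of \<rho> x' x 1] assms by auto
  show ?thesis
  proof (cases "m \<in> M \<and> x \<notin> boundary0 \<rho> M")
    case True
    then have m0: "m \<in> boundary0 \<rho> M"
      using boundary0I(1)[of \<rho> M m x'] assms m infnorm_sub[of m] by simp
    have ge: "\<rho> \<le> infnorm (x - y)" if "y \<in> boundary0 \<rho> M" for y
      using that True grid_infnorm_ge[of \<rho> x y] assms boundary0_subset_grid[of M \<rho>] by blast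
    then have "infnorm (x - m) = \<rho>" using m0 m(3) infnorm_sub[of m] by force
    then have "max_dist x (boundary0 \<rho> M) = ereal \<rho>"
      using max_dist_eq_grid_iff[of \<rho> x "boundary0 \<rho> M" \<rho>] boundary0_subset_grid[of M \<rho>] assms m0 ge
      by auto
    then show ?thesis using assms by (simp add: boundary_layer_def)
  next
    case False
    then show ?thesis using boundary0I(1)[of \<rho> M x m] assms m infnorm_sub[of m] by auto
  qed
qed

text \<open>If \<open>x'\<close> is not in layer 1, every member of \<open>M\<close> is at least two
  steps away. The point \<open>m\<close> between is then outside \<open>M\<close>, which puts
  \<open>x\<close> in layer 0 at distance exactly \<open>2 * \<rho>\<close>.\<close>

lemma mem_outer_layers:
  assumes "0 < \<rho>" "M \<subseteq> grid \<rho>" "x \<in> M" "x' \<in> grid \<rho> - M" "infnorm (x - x') < 3 * \<rho>"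
  shows "x' \<in> boundary_layer \<rho> 1 M \<union> boundary_layer \<rho> 2 M"
proof (cases "x' \<in> boundary_layer \<rho> 1 M")
  case False
  have ge: "2 * \<rho> \<le> infnorm (x' - y)" if "y \<in> M" for y
  proof (rule ccontr)
    assume "\<not> 2 * \<rho> \<le> infnorm (x' - y)"
    then have "infnorm (y - x') = \<rho>"
      using boundary0I(2)[of \<rho> M y x'] that assms infnorm_sub[of x' y] by simp
    then show False using False boundary_layer_1_iff[of \<rho> M x'] assms that by blast
  qed
  have le: "infnorm (x' - x) \<le> real (Suc 1) * \<rho>"
    using grid_infnorm_le[of \<rho> x' x 2] assms infnorm_sub[of x'] by auto
  then obtain m where m: "m \<in> grid \<rho>" "infnorm (x' - m) \<le> \<rho>" "infnorm (m - x) \<le> \<rho>"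
    using grid_step_towards[of \<rho> x' x 1] assms by auto
  have "m \<notin> M" using ge[of m] m(2) \<open>0 < \<rho>\<close> by auto
  then have "x \<in> boundary0 \<rho> M" using boundary0I(1)[of \<rho> M x m] assms m infnorm_sub[of m] by simp
  moreover have "infnorm (x' - x) = 2 * \<rho>" using ge[OF \<open>x \<in> M\<close>] le by simp
  moreover have "boundary0 \<rho> M \<subseteq> M" by (auto simp: boundary0_def)
  ultimately have "max_dist x' (boundary0 \<rho> M) = ereal (2 * \<rho>)"
    using max_dist_eq_grid_iff[of \<rho> x' "boundary0 \<rho> M" "2 * \<rho>"] boundary0_subset_grid[of M \<rho>] assms ge
    by auto
  then show ?thesis using assms by (simp add: boundary_layer_def)
qed simp

lemma outer_layer_near_boundary0:
  assumes "0 < \<rho>" "M \<subseteq> grid \<rho>" "z \<in> boundary_layer \<rho> 1 M \<union> boundary_layer \<rho> 2 M"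
  obtains x where "x \<in> boundary0 \<rho> M" "infnorm (x - z) \<le> 2 * \<rho>"
proof -
  from assms(3) obtain c where c: "c = \<rho> \<or> c = 2 * \<rho>" "max_dist z (boundary0 \<rho> M) = ereal c"
    and z: "z \<in> grid \<rho>"
    by (auto simp: boundary_layer_def)
  then obtain x where "x \<in> boundary0 \<rho> M" "infnorm (z - x) = c"
    using max_dist_eq_grid_iff[OF assms(1) z boundary0_subset_grid[OF assms(2)]] by blast
  then show ?thesis using that c(1) assms(1) infnorm_sub[of z] by auto
qed

text \<open>On a shortest grid path from \<open>x\<close> to \<open>y\<close>, the first point in \<open>boundary0 \<rho> M\<close> or
  \<open>boundary_layer \<rho> 1 M\<close> lies in \<open>M\<close> iff \<open>x\<close> does, so the two layers determine \<open>M\<close>.\<close>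

lemma tr_eq_imp_mem:
  assumes "0 < \<rho>" "M \<subseteq> grid \<rho>" "N \<subseteq> grid \<rho>" "tr \<rho> M = tr \<rho> N"
    and "x \<in> M" "y \<in> N" "infnorm (y - x) \<le> real n * \<rho>"
  shows "x \<in> N"
  using assms(5-7)
proof (induction n arbitrary: x)
  case 0
  then show ?case using infnorm_pos_lt[of "y - x"] by force
next
  case (Suc n)
  obtain m where m: "m \<in> grid \<rho>" "infnorm (y - m) \<le> real n * \<rho>" "infnorm (m - x) \<le> \<rho>"
    using grid_step_towards[of \<rho> y x n] Suc.prems assms(1-3) by blast
  have eq: "boundary0 \<rho> M = boundary0 \<rho> N"
    using assms(4) by (simp add: tr_def boundary_layer_def)
  show ?case
  proof (cases "m \<in> M")
    case True
    then have "m \<in> N" using Suc.IH m(2) Suc.prems by blast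
    show ?thesis
    proof (rule ccontr)
      assume x: "x \<notin> N"
      then have "infnorm (m - x) = \<rho>"
        using boundary0I(2)[of \<rho> N m x] \<open>m \<in> N\<close> Suc.prems assms(1-3) m(3) by auto
      then have "x \<in> boundary_layer \<rho> 1 N"
        using boundary_layer_1_iff[of \<rho> N x] assms(1-3) x Suc.prems(1) \<open>m \<in> N\<close> by blast
      then have "x \<in> boundary_layer \<rho> 1 M" using assms(4) by (simp add: tr_def)
      then show False using Suc.prems(1) boundary_layer_1_iff[of \<rho> M x] assms(1-3) by blast
    qed
  next
    case False
    then have "x \<in> boundary0 \<rho> M"
      using boundary0I(1)[of \<rho> M x m] m Suc.prems assms(1-3) infnorm_sub[of m] by auto
    then show ?thesis unfolding eq by (auto simp: boundary0_def)
  qed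
qed

text \<open>Any two grid points are finitely many steps apart, so \<open>tr_eq_imp_mem\<close> gives
  both inclusions; nonemptiness supplies its reference point \<open>y\<close>.\<close>

lemma inj_on_tr: "0 < \<rho> \<Longrightarrow> inj_on (tr \<rho>) (grid_sets \<rho>)"
proof (rule inj_onI)
  have sub: "M \<subseteq> N"
    if *: "0 < \<rho>" "M \<in> grid_sets \<rho>" "N \<in> grid_sets \<rho>" "tr \<rho> M = tr \<rho> N"
    for M N :: "(real ^ 'd) set"
  proof
    fix x assume "x \<in> M"
    obtain y where "y \<in> N" using * unfolding grid_sets_def by blast
    moreover from this obtain n where "infnorm (y - x) = \<rho> * real n"
      using grid_infnorm_multiple[of \<rho> y x] * \<open>x \<in> M\<close> unfolding grid_sets_def by blast
    ultimately show "x \<in> N"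
      using tr_eq_imp_mem[of \<rho> M N x y n] * \<open>x \<in> M\<close>
      by (simp add: grid_sets_def mult.commute)
  qed
  fix M N :: "(real ^ 'd) set"
  assume "0 < \<rho>" "M \<in> grid_sets \<rho>" "N \<in> grid_sets \<rho>" "tr \<rho> M = tr \<rho> N"
  then show "M = N" using sub[of M N] sub[of N M] by auto
qed

section \<open>Euler map: Lipschitz estimates and exact solutions\<close>

lemma max_hausdorff_leD:
  assumes "max_hausdorff A B \<le> ereal c" "compact B" "B \<noteq> {}" "a \<in> A"
  obtains b where "b \<in> B" "infnorm (a - b) \<le> c"
proof -
  \<comment> \<open>Compactness makes the distance attained, so the selected point meets the bound
    \<open>c\<close> without any slack.\<close>
  have "continuous_on B (\<lambda>b. infnorm (a - b))" by (intro continuous_intros)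
  then obtain b where b: "b \<in> B" "\<And>b'. b' \<in> B \<Longrightarrow> infnorm (a - b) \<le> infnorm (a - b')"
    using continuous_attains_inf[OF assms(2,3)] by blast
  have "ereal (infnorm (a - b)) \<le> max_dist a B"
    unfolding max_dist_def using b(2) by (intro INF_greatest) simp
  also have "\<dots> \<le> max_hausdorff A B"
    unfolding max_hausdorff_def using assms(4) by (intro max.coboundedI1 SUP_upper)
  finally have "infnorm (a - b) \<le> c" using assms(1) order_trans ereal_less_eq(3) by blast
  then show ?thesis using that b(1) by blast
qed

locale lipschitz_inclusion =
  fixes F :: "real ^ 'd \<Rightarrow> (real ^ 'd) set" and L P h :: real
  assumes compact_F: "compact (F x)" and convex_F: "convex (F x)" and F_ne: "F x \<noteq> {}"
    and F_lipschitz: "max_hausdorff (F x) (F y) \<le> ereal (L * infnorm (x - y))"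
    and F_bound: "f \<in> F x \<Longrightarrow> infnorm f \<le> P"
    and L_pos: "0 < L" and h_pos: "0 < h" and Lh: "L * h \<le> 1 / 4"
begin

lemma F_select:
  assumes "f \<in> F x"
  obtains g where "g \<in> F y" "infnorm (f - g) \<le> L * infnorm (x - y)"
  using max_hausdorff_leD[OF F_lipschitz compact_F F_ne assms] .

abbreviation \<phi> :: "real ^ 'd \<Rightarrow> (real ^ 'd) set" where "\<phi> \<equiv> euler F h"

lemma euler_eq: "\<phi> x = (\<lambda>f. x + h *\<^sub>R f) ` F x"
  by (auto simp: euler_def)

lemma compact_euler: "compact (\<phi> x)"
  unfolding euler_eq by (intro compact_continuous_image continuous_intros compact_F)

lemma convex_euler: "convex (\<phi> x)"
  unfolding euler_eq using convex_affinity[OF convex_F, of x h x] by simp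

lemma frontier_euler_subset: "frontier (\<phi> x) \<subseteq> \<phi> x"
  using frontier_subset_closed compact_imp_closed compact_euler by blast

lemma euler_lipschitz: "\<phi> x \<subseteq> nbhd ((1 + L * h) * infnorm (x - y)) (\<phi> y)"
proof
  fix z assume "z \<in> \<phi> x"
  then obtain f where f: "f \<in> F x" "z = x + h *\<^sub>R f" by (auto simp: euler_def)
  then obtain g where g: "g \<in> F y" "infnorm (f - g) \<le> L * infnorm (x - y)" using F_select by blast
  have "z - (y + h *\<^sub>R g) = (x - y) + h *\<^sub>R (f - g)" by (simp add: f(2) algebra_simps)
  then have "infnorm (z - (y + h *\<^sub>R g)) \<le> infnorm (x - y) + h * infnorm (f - g)"
    using infnorm_triangle[of "x - y" "h *\<^sub>R (f - g)"] h_pos by (simp only: infnorm_mul abs_of_pos)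
  also have "\<dots> \<le> infnorm (x - y) + h * (L * infnorm (x - y))"
    using g(2) h_pos by (intro add_left_mono mult_left_mono) auto
  finally show "z \<in> nbhd ((1 + L * h) * infnorm (x - y)) (\<phi> y)"
    using g(1) by (intro nbhdI[of "y + h *\<^sub>R g"]) (auto simp: euler_def algebra_simps)
qed

lemma euler_lipschitz_le: "infnorm (x - y) \<le> c \<Longrightarrow> \<phi> x \<subseteq> nbhd ((1 + L * h) * c) (\<phi> y)"
proof
  fix z assume c: "infnorm (x - y) \<le> c" and "z \<in> \<phi> x"
  then have z: "z \<in> nbhd ((1 + L * h) * infnorm (x - y)) (\<phi> y)" using euler_lipschitz by blast
  have "(1 + L * h) * infnorm (x - y) \<le> (1 + L * h) * c"
    using c L_pos h_pos by (intro mult_left_mono) auto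
  then show "z \<in> nbhd ((1 + L * h) * c) (\<phi> y)" 
    using nbhd_triangle[OF z, of z 0] by (simp add: infnorm_0)
qed

text \<open>Each \<open>snd (s n)\<close> is compared with a nearby point of the fixed closed set
  \<open>F x\<close>; the two sequences share their limit. This gives closedness of the set over
  which \<open>euler_solve\<close> minimises.\<close>

lemma closed_graph_F: "closed {p. snd p \<in> F (fst p)}"
  unfolding closed_sequential_limits
proof clarsimp
  fix s :: "nat \<Rightarrow> (real ^ 'd) \<times> (real ^ 'd)" and x f
  assume mem: "\<forall>n. snd (s n) \<in> F (fst (s n))" and lim: "s \<longlonglongrightarrow> (x, f)"
  have "\<exists>g\<in>F x. infnorm (snd (s n) - g) \<le> L * infnorm (fst (s n) - x)" for n
    using mem F_select[of "snd (s n)" "fst (s n)" x] by blast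
  then obtain g where g: "\<And>n. g n \<in> F x" "\<And>n. infnorm (snd (s n) - g n) \<le> L * infnorm (fst (s n) - x)"
    by metis
  have fst: "(\<lambda>n. fst (s n)) \<longlonglongrightarrow> x" and snd: "(\<lambda>n. snd (s n)) \<longlonglongrightarrow> f"
    using tendsto_fst[OF lim] tendsto_snd[OF lim] by auto
  have "(\<lambda>n. L * infnorm (fst (s n) - x)) \<longlonglongrightarrow> L * infnorm (x - x)"
    by (intro tendsto_intros fst)
  then have bound: "(\<lambda>n. sqrt DIM(real ^ 'd) * (L * infnorm (fst (s n) - x))) \<longlonglongrightarrow> 0"
    using tendsto_mult_right_zero by (simp add: infnorm_0)
  have "norm (snd (s n) - g n) \<le> sqrt DIM(real ^ 'd) * (L * infnorm (fst (s n) - x))" for n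
    by (rule order_trans[OF norm_le_infnorm mult_left_mono[OF g(2)]]) simp
  then have "(\<lambda>n. snd (s n) - g n) \<longlonglongrightarrow> 0"
    by (intro Lim_null_comparison[OF _ bound]) simp
  then have "g \<longlonglongrightarrow> f" using tendsto_diff[OF snd, of "\<lambda>n. snd (s n) - g n" 0] by simp
  then show "f \<in> F x" using closed_sequentially[OF compact_imp_closed[OF compact_F]] g(1) by blast
qed

text \<open>A fixed point of the contraction \<open>y \<mapsto> z - h F(y)\<close>: one contraction step decreases
  the residual \<open>z - y - h f\<close> without leaving the compact set \<open>K\<close>, so the residual vanishes at
  its minimum over \<open>K\<close>.\<close>

lemma euler_solve:
  assumes "z \<in> nbhd c (\<phi> x)"
  obtains y where "z \<in> \<phi> y" "infnorm (y - x) \<le> 4 / 3 * c"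
proof -
  define res where "res p = infnorm (z - fst p - h *\<^sub>R snd p)" for p
  \<comment> \<open>The weight is \<open>3 / 4 = 1 - 1 / 4\<close>: a contraction step moves
    \<open>y\<close> by at most the residual and leaves at most a quarter of it, so the weighted sum
    does not grow. It also yields the final factor \<open>4 / 3\<close>.\<close>
  define K where "K = {p. snd p \<in> F (fst p) \<and> res p + 3 / 4 * infnorm (fst p - x) \<le> c}"
  have res_cont: "continuous_on S res" for S unfolding res_def by (intro continuous_intros)
  have "K \<subseteq> max_ball (4 / 3 * c) x \<times> max_ball P 0"
  proof
    fix p assume "p \<in> K"
    then have "snd p \<in> F (fst p)" "res p + 3 / 4 * infnorm (fst p - x) \<le> c" by (auto simp: K_def)
    moreover have "0 \<le> res p" by (simp add: res_def infnorm_pos_le)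
    ultimately show "p \<in> max_ball (4 / 3 * c) x \<times> max_ball P 0"
      using F_bound by (cases p) (auto simp: mem_max_ball)
  qed
  moreover have "closed K"
  proof -
    have "K = {p. snd p \<in> F (fst p)} \<inter> {p. res p + 3 / 4 * infnorm (fst p - x) \<le> c}"
      by (auto simp: K_def)
    moreover have "closed {p. res p + 3 / 4 * infnorm (fst p - x) \<le> c}"
      by (intro closed_Collect_le continuous_intros res_cont)
    ultimately show ?thesis using closed_graph_F by auto
  qed
  ultimately have "compact K"
    using compact_Int_closed[OF compact_Times[OF compact_max_ball compact_max_ball] \<open>closed K\<close>,
        of "4 / 3 * c" x P 0]
    by (simp only: Int_absorb1)
  moreover obtain f0 where "f0 \<in> F x" "infnorm (z - (x + h *\<^sub>R f0)) \<le> c"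
    using assms by (auto simp: mem_nbhd euler_def)
  then have "(x, f0) \<in> K" by (simp add: K_def res_def infnorm_0 algebra_simps)
  ultimately obtain p where p: "p \<in> K" "\<And>p'. p' \<in> K \<Longrightarrow> res p \<le> res p'"
    using continuous_attains_inf[of K res] res_cont by blast
  obtain y f where yf: "p = (y, f)" by (cases p)
  have f: "f \<in> F y" and pK: "res p + 3 / 4 * infnorm (y - x) \<le> c"
    using p(1) by (auto simp: K_def yf)
  let ?y = "z - h *\<^sub>R f"
  obtain g where g: "g \<in> F ?y" "infnorm (f - g) \<le> L * infnorm (y - ?y)" using F_select f by blast
  have step: "infnorm (y - ?y) = res p"
    using infnorm_sub[of y ?y] by (simp add: res_def yf algebra_simps)
  have "res (?y, g) = infnorm (h *\<^sub>R (f - g))"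
    by (simp add: res_def algebra_simps)
  also have "\<dots> \<le> h * (L * res p)"
    using g(2) h_pos unfolding step by (simp add: infnorm_mul)
  also have "\<dots> \<le> 1 / 4 * res p"
    using mult_right_mono[OF Lh, of "res p"] infnorm_pos_le[of "z - fst p - h *\<^sub>R snd p"]
    by (simp add: res_def mult_ac)
  finally have small: "res (?y, g) \<le> 1 / 4 * res p" .
  have "infnorm (?y - x) \<le> res p + infnorm (y - x)"
    using infnorm_triangle3[of ?y x y] step infnorm_sub[of y ?y] by simp
  then have "(?y, g) \<in> K" using small pK g(1) by (simp add: K_def)
  then have "res p \<le> 0" using p(2)[of "(?y, g)"] small by simp
  then have "z - y - h *\<^sub>R f = 0"
    using infnorm_pos_lt[of "z - y - h *\<^sub>R f"] by (force simp: res_def yf)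
  then have "z = y + h *\<^sub>R f" by (simp add: algebra_simps)
  then have "z \<in> \<phi> y" using f by (auto simp: euler_def)
  moreover have "infnorm (y - x) \<le> 4 / 3 * c"
    using pK infnorm_pos_le[of "z - y - h *\<^sub>R f"] by (simp add: res_def yf)
  ultimately show ?thesis by (rule that)
qed

text \<open>By convexity the midpoint of two solutions has residual at most \<open>L h\<close> times half their
  distance, so there is a solution strictly closer to both.\<close>

lemma euler_midpoint:
  assumes "z \<in> \<phi> y1" "z \<in> \<phi> y2"
  obtains y where "z \<in> \<phi> y"
    "infnorm (y - y1) \<le> 2 / 3 * infnorm (y1 - y2)" "infnorm (y - y2) \<le> 2 / 3 * infnorm (y1 - y2)"
proof -
  define m where "m = (1 / 2) *\<^sub>R y1 + (1 / 2) *\<^sub>R y2"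
  let ?d = "infnorm (y1 - y2)"
  have "m - y1 = (- 1 / 2) *\<^sub>R (y1 - y2)" "m - y2 = (1 / 2) *\<^sub>R (y1 - y2)"
    by (simp_all add: m_def vec_eq_iff field_simps)
  then have m: "infnorm (m - y1) = ?d / 2" "infnorm (m - y2) = ?d / 2"
    by (simp_all only: infnorm_mul)
  obtain f1 f2 where f: "f1 \<in> F y1" "z = y1 + h *\<^sub>R f1" "f2 \<in> F y2" "z = y2 + h *\<^sub>R f2"
    using assms unfolding euler_def by blast
  obtain g1 g2 where g: "g1 \<in> F m" "infnorm (f1 - g1) \<le> L * (?d / 2)"
    "g2 \<in> F m" "infnorm (f2 - g2) \<le> L * (?d / 2)"
  proof -
    obtain g1 where "g1 \<in> F m" "infnorm (f1 - g1) \<le> L * infnorm (y1 - m)"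
      using F_select[OF f(1)] .
    moreover obtain g2 where "g2 \<in> F m" "infnorm (f2 - g2) \<le> L * infnorm (y2 - m)"
      using F_select[OF f(3)] .
    ultimately show ?thesis using that m by (simp add: infnorm_sub[of _ m])
  qed
  let ?g = "(1 / 2) *\<^sub>R g1 + (1 / 2) *\<^sub>R g2"
  have "?g \<in> F m" using convexD[OF convex_F g(1,3)] by simp
  have "z = (1 / 2) *\<^sub>R (y1 + h *\<^sub>R f1) + (1 / 2) *\<^sub>R (y2 + h *\<^sub>R f2)"
    unfolding f(2,4)[symmetric] by (simp add: vec_eq_iff)
  then have "z - (m + h *\<^sub>R ?g) = (h / 2) *\<^sub>R ((f1 - g1) + (f2 - g2))"
    by (simp add: m_def vec_eq_iff field_simps)
  then have "infnorm (z - (m + h *\<^sub>R ?g)) = h / 2 * infnorm ((f1 - g1) + (f2 - g2))"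
    using h_pos by (simp only: infnorm_mul)
  also have "\<dots> \<le> h / 2 * (L * ?d)"
    using g(2,4) infnorm_triangle[of "f1 - g1" "f2 - g2"] h_pos by (intro mult_left_mono) auto
  also have "\<dots> \<le> 1 / 8 * ?d"
    using mult_right_mono[OF Lh, of "?d"] infnorm_pos_le[of "y1 - y2"] by (simp add: mult_ac)
  \<comment> \<open>Solving from \<open>m\<close> costs \<open>4 / 3 * 1 / 8 = 1 / 6\<close> of the
    distance; with the half from \<open>m\<close> to either end this makes
    \<open>2 / 3\<close>.\<close>
  finally have "z \<in> nbhd (1 / 8 * ?d) (\<phi> m)"
    using \<open>?g \<in> F m\<close> by (intro nbhdI[of "m + h *\<^sub>R ?g"]) (auto simp: euler_def)
  then obtain y where y: "z \<in> \<phi> y" "infnorm (y - m) \<le> 4 / 3 * (1 / 8 * ?d)"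
    using euler_solve by blast
  show ?thesis
    using that[OF y(1)] y(2) m infnorm_triangle3[of y y1 m] infnorm_triangle3[of y y2 m] by simp
qed

text \<open>The reason for the blow-up radius: an exact solution can be rounded to a nearest grid
  point, and that point still hits \<open>z\<close>.\<close>

lemma euler_hit_nearby:
  assumes "z \<in> \<phi> y" "infnorm (y - x) \<le> \<rho> / 2"
  shows "z \<in> nbhd ((1 + L * h) * (\<rho> / 2)) (\<phi> x)"
  using euler_lipschitz_le[OF assms(2)] assms(1) by blast

end

section \<open>Images of grid sets and a criterion for boundary layers\<close>

lemma mem_set_image_Phi:
  "z \<in> set_image (Phi F \<alpha> h \<tau>) M \<longleftrightarrow> z \<in> grid \<tau> \<and> (\<exists>x\<in>M. z \<in> nbhd \<alpha> (euler F h x))"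
  by (auto simp: set_image_def Phi_def proj_def)

lemma mem_set_image_Phi_bd:
  "z \<in> set_image (Phi_bd F \<alpha> h \<tau>) M \<longleftrightarrow>
    z \<in> grid \<tau> \<and> (\<exists>x\<in>M. z \<in> nbhd \<alpha> (frontier (euler F h x)))"
  by (auto simp: set_image_def Phi_bd_def proj_def)

lemma set_image_regrid:
  "set_image (\<lambda>x. regrid \<rho> (G x)) M = regrid \<rho> (set_image G M)"
  by (auto simp: set_image_def regrid_def nbhd_def)

lemma nbhd_mono: "r \<le> s \<Longrightarrow> A \<subseteq> B \<Longrightarrow> nbhd r A \<subseteq> nbhd s B"
  unfolding mem_nbhd subset_iff using order_trans by blast

text \<open>It suffices that \<open>W0\<close> and \<open>W1\<close> cover the layers 0 and 1, as
  long as \<open>W0\<close> stays inside \<open>N\<close> and \<open>W1\<close> meets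
  \<open>N\<close> only in \<open>W0\<close>. Positive distance from \<open>W0\<close> then removes
  from \<open>W1\<close> everything in \<open>N\<close>, and adjacency to the resulting outer layer
  cuts \<open>W0\<close> down to layer 0.\<close>

lemma tr_eqI:
  assumes "0 < \<tau>" and N: "N \<subseteq> grid \<tau>"
    and W0: "W0 \<subseteq> N" and W1: "W1 \<subseteq> grid \<tau>" "W1 \<inter> N \<subseteq> W0"
    and layer0: "boundary0 \<tau> N \<subseteq> W0" and layer1: "boundary_layer \<tau> 1 N \<subseteq> W1"
  defines "E1 \<equiv> {x \<in> W1. max_dist x W0 = ereal \<tau>}"
  defines "E0 \<equiv> {x \<in> W0. max_dist x E1 = ereal \<tau>}"
  shows "(E0, E1) = tr \<tau> N"
proof -
  have W0g: "W0 \<subseteq> grid \<tau>" using W0 N by blast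
  have E1: "E1 = boundary_layer \<tau> 1 N"
  proof (intro equalityI subsetI)
    fix z assume "z \<in> E1"
    then have z: "z \<in> W1" "max_dist z W0 = ereal \<tau>" by (auto simp: E1_def)
    then have zg: "z \<in> grid \<tau>" using W1(1) by blast
    from z(2) obtain w where w: "w \<in> W0" "infnorm (z - w) = \<tau>" and ge: "\<And>w. w \<in> W0 \<Longrightarrow> \<tau> \<le> infnorm (z - w)"
      using max_dist_eq_grid_iff[OF assms(1) zg W0g] by blast
    have "z \<notin> W0" using ge[of z] assms(1) by (auto simp: infnorm_0)
    then have "z \<notin> N" using z(1) W1(2) by blast
    then show "z \<in> boundary_layer \<tau> 1 N"
      using boundary_layer_1_iff[OF assms(1) N] zg w W0 infnorm_sub[of z w] by auto
  next
    fix z assume z: "z \<in> boundary_layer \<tau> 1 N"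
    then obtain x where zx: "z \<in> grid \<tau> - N" "x \<in> N" "infnorm (x - z) = \<tau>"
      using boundary_layer_1_iff[OF assms(1) N] by blast
    then have "x \<in> W0" using layer0 by (auto simp: boundary0_def)
    moreover have "\<tau> \<le> infnorm (z - w)" if "w \<in> W0" for w
      using that W0 W0g grid_infnorm_ge[of \<tau> z w] assms(1) zx(1) by blast
    ultimately have "max_dist z W0 = ereal \<tau>"
      using max_dist_eq_grid_iff[OF assms(1) _ W0g, of z \<tau>] zx infnorm_sub[of z x] by auto
    then show "z \<in> E1" using z layer1 by (auto simp: E1_def)
  qed
  have E1g: "E1 \<subseteq> grid \<tau> - N" using E1 boundary_layer_1_iff[OF assms(1) N] by blast
  have "E0 = boundary0 \<tau> N"
  proof (intro equalityI subsetI)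
    fix z assume "z \<in> E0"
    then have z: "z \<in> W0" "max_dist z E1 = ereal \<tau>" by (auto simp: E0_def)
    then obtain w where "w \<in> E1" "infnorm (z - w) = \<tau>"
      using max_dist_eq_grid_iff[of \<tau> z E1 \<tau>] assms(1) W0g E1g by blast
    then show "z \<in> boundary0 \<tau> N" using z(1) W0 E1g by (auto simp: boundary0_def)
  next
    fix z assume z: "z \<in> boundary0 \<tau> N"
    then obtain w where w: "z \<in> N" "w \<in> grid \<tau> - N" "infnorm (z - w) = \<tau>"
      by (auto simp: boundary0_def)
    then have "w \<in> E1" unfolding E1 boundary_layer_1_iff[OF assms(1) N] by blast
    moreover have "\<tau> \<le> infnorm (z - w)" if "w \<in> E1" for w
      using that E1g w(1) grid_infnorm_ge[of \<tau> z w] N assms(1) by blast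
    ultimately have "max_dist z E1 = ereal \<tau>"
      using max_dist_eq_grid_iff[of \<tau> z E1 \<tau>] assms(1) w N E1g by blast
    then show "z \<in> E0" using z layer0 by (auto simp: E0_def)
  qed
  then show ?thesis using E1 by (simp add: tr_def boundary_layer_def)
qed

section \<open>Boundary layers of the Euler image of a grid set\<close>

context lipschitz_inclusion
begin

context
  fixes \<rho> \<tau> \<alpha> :: real and M :: "(real ^ 'd) set"
  assumes rho: "0 < \<rho>" and tau: "0 < \<tau>" "\<tau> \<le> \<rho>"
    and alpha: "\<alpha> = (1 + L * h) * (\<rho> / 2)" and M: "M \<subseteq> grid \<rho>"
begin

lemma alpha_bounds: "\<rho> / 2 \<le> \<alpha>" "\<alpha> \<le> 5 / 8 * \<rho>"
proof -
  have "0 \<le> (L * h) * \<rho>" "(L * h) * \<rho> \<le> 1 / 4 * \<rho>"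
    using L_pos h_pos rho mult_right_mono[OF Lh, of \<rho>] by auto
  then show "\<rho> / 2 \<le> \<alpha>" "\<alpha> \<le> 5 / 8 * \<rho>" unfolding alpha by (simp_all add: algebra_simps)
qed

lemma hit_from_nearest:
  assumes "z \<in> \<phi> y" "infnorm (x - y) \<le> \<rho> / 2"
  shows "z \<in> nbhd \<alpha> (\<phi> x)"
  unfolding alpha using assms by (intro euler_hit_nearby) (auto simp: infnorm_sub)

text \<open>Bisection: \<open>euler_midpoint\<close> inserts a solution, its nearest grid point is
  inside or outside \<open>M\<close>, and one of the two pairs still crosses. Each round shrinks the
  gap by \<open>2 / 3\<close>; the number \<open>n\<close> counts the rounds until the gap is at
  most \<open>\<rho> / 2\<close>.\<close>

lemma hit_from_boundary_if_solutions_cross: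
  assumes "infnorm (y1 - y2) \<le> (3 / 2) ^ n * (\<rho> / 2)" "z \<in> \<phi> y1" "z \<in> \<phi> y2"
    "x1 \<in> M" "infnorm (x1 - y1) \<le> \<rho> / 2" "x2 \<in> grid \<rho> - M" "infnorm (x2 - y2) \<le> \<rho> / 2"
  shows "\<exists>x\<in>boundary0 \<rho> M. z \<in> nbhd \<alpha> (\<phi> x)"
  using assms
proof (induction n arbitrary: y1 y2 x1 x2)
  case 0
  \<comment> \<open>Three legs of at most \<open>\<rho> / 2\<close> each, from \<open>x1\<close> via
    \<open>y1\<close> and \<open>y2\<close> to \<open>x2\<close>.\<close>
  have "infnorm (x1 - x2) < 2 * \<rho>"
    using 0 rho infnorm_triangle3[of x1 x2 y1] infnorm_triangle3[of y1 x2 y2] infnorm_sub[of y2 x2]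
    by simp
  then have "x1 \<in> boundary0 \<rho> M" using boundary0I(1)[OF rho M] 0 by blast
  then show ?case using hit_from_nearest 0 by blast
next
  case (Suc n)
  obtain y where y: "z \<in> \<phi> y"
    "infnorm (y - y1) \<le> 2 / 3 * infnorm (y1 - y2)" "infnorm (y - y2) \<le> 2 / 3 * infnorm (y1 - y2)"
    using euler_midpoint Suc.prems(2,3) by blast
  then have small: "infnorm (y1 - y) \<le> (3 / 2) ^ n * (\<rho> / 2)" "infnorm (y - y2) \<le> (3 / 2) ^ n * (\<rho> / 2)"
    using Suc.prems(1) infnorm_sub[of y y1] by auto
  obtain x where x: "x \<in> grid \<rho>" "infnorm (x - y) \<le> \<rho> / 2" using grid_nearest[OF rho] .
  show ?case
  proof (cases "x \<in> M")
    case True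
    then show ?thesis using Suc.IH[OF small(2) y(1) Suc.prems(3) True x(2) Suc.prems(6,7)] by blast
  next
    case False
    then show ?thesis using Suc.IH[OF small(1) Suc.prems(2) y(1) Suc.prems(4,5) _ x(2)] x(1) by blast
  qed
qed

text \<open>Passing to \<open>z'\<close> enlarges the residual to \<open>\<alpha> + s\<close>;
  solving exactly moves \<open>x\<close> by at most \<open>4 / 3\<close> of that, and rounding to
  the grid adds \<open>\<rho> / 2\<close>.\<close>

lemma hit_neighbour:
  assumes "z \<in> nbhd \<alpha> (\<phi> x)" "infnorm (z' - z) \<le> s"
  obtains y x' where "z' \<in> \<phi> y" "x' \<in> grid \<rho>" "infnorm (x' - y) \<le> \<rho> / 2" "z' \<in> nbhd \<alpha> (\<phi> x')"
    "infnorm (x - x') \<le> 4 / 3 * (\<alpha> + s) + \<rho> / 2"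
proof -
  have "z' \<in> nbhd (\<alpha> + s) (\<phi> x)" using nbhd_triangle assms by blast
  then obtain y where y: "z' \<in> \<phi> y" "infnorm (y - x) \<le> 4 / 3 * (\<alpha> + s)" using euler_solve by blast
  obtain x' where x': "x' \<in> grid \<rho>" "infnorm (x' - y) \<le> \<rho> / 2" using grid_nearest[OF rho] .
  have "infnorm (x - x') \<le> 4 / 3 * (\<alpha> + s) + \<rho> / 2"
    using y(2) x'(2) infnorm_triangle3[of x x' y] infnorm_sub[of x' y] infnorm_sub[of x y] by linarith
  then show ?thesis using that[OF y(1) x' hit_from_nearest[OF y(1) x'(2)]] by blast
qed

text \<open>Both hits are replaced by exact solutions with nearest grid points \<open>x1'\<close>
  and \<open>x2'\<close>. If these stay on their sides of \<open>M\<close>, bisection applies; if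
  one changes sides, it is a grid neighbour of its origin and the member of that pair is in layer
  0.\<close>

lemma hit_from_boundary_if_hits_cross:
  assumes "x1 \<in> M" "z \<in> nbhd \<alpha> (\<phi> x1)" "x2 \<in> grid \<rho> - M" "z \<in> nbhd \<alpha> (\<phi> x2)"
  shows "\<exists>x\<in>boundary0 \<rho> M. z \<in> nbhd \<alpha> (\<phi> x)"
proof -
  \<comment> \<open>With \<open>\<alpha> \<le> 5 / 8 * \<rho>\<close> the left side is at most
    \<open>4 / 3 * \<rho>\<close>.\<close>
  have small: "4 / 3 * (\<alpha> + 0) + \<rho> / 2 < 2 * \<rho>" using alpha_bounds rho by simp
  obtain y1 x1' where 1: "z \<in> \<phi> y1" "x1' \<in> grid \<rho>" "infnorm (x1' - y1) \<le> \<rho> / 2"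
    "z \<in> nbhd \<alpha> (\<phi> x1')" "infnorm (x1 - x1') \<le> 4 / 3 * (\<alpha> + 0) + \<rho> / 2"
    using hit_neighbour[OF assms(2), of z 0] by (auto simp: infnorm_0)
  obtain y2 x2' where 2: "z \<in> \<phi> y2" "x2' \<in> grid \<rho>" "infnorm (x2' - y2) \<le> \<rho> / 2"
    "z \<in> nbhd \<alpha> (\<phi> x2')" "infnorm (x2 - x2') \<le> 4 / 3 * (\<alpha> + 0) + \<rho> / 2"
    using hit_neighbour[OF assms(4), of z 0] by (auto simp: infnorm_0)
  show ?thesis
  proof (cases "x1' \<in> M \<and> x2' \<notin> M")
    case True
    obtain n where "infnorm (y1 - y2) / (\<rho> / 2) < (3 / 2) ^ n"
      using real_arch_pow[of "3 / 2"] by auto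
    then have "infnorm (y1 - y2) \<le> (3 / 2) ^ n * (\<rho> / 2)"
      using rho by (simp add: field_simps)
    then show ?thesis
      using hit_from_boundary_if_solutions_cross 1 2 True by blast
  next
    case False
    then consider "x1' \<notin> M" | "x2' \<in> M" by blast
    then show ?thesis
    proof cases
      case 1
      then have "x1 \<in> boundary0 \<rho> M"
        using boundary0I(1)[OF rho M assms(1), of x1'] \<open>x1' \<in> grid \<rho>\<close> 
          \<open>infnorm (x1 - x1') \<le> _\<close> small by simp
      then show ?thesis using assms(2) by blast
    next
      case 2
      then have "x2' \<in> boundary0 \<rho> M"
        using boundary0I(1)[OF rho M 2 assms(3)] \<open>infnorm (x2 - x2') \<le> _\<close> small infnorm_sub[of x2]
        by simp
      then show ?thesis using \<open>z \<in> nbhd \<alpha> (\<phi> x2')\<close> by blast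
    qed
  qed
qed

lemma Phi_grid_subset: "set_image (Phi F \<alpha> h \<tau>) M \<subseteq> grid \<tau>"
  by (auto simp: mem_set_image_Phi)

text \<open>A neighbour \<open>z'\<close> outside the image is hit by a grid point outside
  \<open>M\<close> at most two steps from \<open>x\<close>, which confines \<open>x\<close> to the
  layers 0 and -1. Were the frontier of \<open>\<phi> x\<close> too far from \<open>z\<close>, the
  \<alpha>-ball at \<open>z\<close> would lie in \<open>\<phi> x\<close> and reach far enough for
  \<open>x\<close> to hit \<open>z'\<close>.\<close>

lemma boundary0_Phi_frontier:
  assumes "z \<in> boundary0 \<tau> (set_image (Phi F \<alpha> h \<tau>) M)"
  shows "\<exists>x\<in>boundary0 \<rho> M \<union> boundary_layer \<rho> (-1) M. z \<in> nbhd \<alpha> (frontier (\<phi> x))"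
proof -
  obtain x z' where x: "x \<in> M" "z \<in> nbhd \<alpha> (\<phi> x)" and z': "z' \<in> grid \<tau>" "infnorm (z - z') = \<tau>"
    and out: "\<And>x. x \<in> M \<Longrightarrow> z' \<notin> nbhd \<alpha> (\<phi> x)"
    using assms by (auto simp: boundary0_def mem_set_image_Phi)
  obtain x' where x': "x' \<in> grid \<rho>" "z' \<in> nbhd \<alpha> (\<phi> x')" "infnorm (x - x') \<le> 4 / 3 * (\<alpha> + \<tau>) + \<rho> / 2"
    using hit_neighbour[OF x(2), of z' \<tau>] z'(2) infnorm_sub[of z'] by auto
  \<comment> \<open>By \<open>\<alpha> \<le> 5 / 8 * \<rho>\<close> and
    \<open>\<tau> \<le> \<rho>\<close> the bound is at most \<open>8 / 3 * \<rho>\<close>.\<close>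
  have near: "infnorm (x - x') < 3 * \<rho>" using x'(3) alpha_bounds tau rho by argo
  have "x' \<in> grid \<rho> - M" using out x'(1,2) by blast
  then have layer: "x \<in> boundary0 \<rho> M \<union> boundary_layer \<rho> (-1) M"
    using mem_inner_layers[OF rho M x(1) _ near] by blast
  have "z \<in> nbhd \<alpha> (frontier (\<phi> x))"
  proof (rule ccontr)
    assume "z \<notin> nbhd \<alpha> (frontier (\<phi> x))"
    then have sub: "max_ball \<alpha> z \<subseteq> \<phi> x" using max_ball_subset_if_frontier_far x(2) by blast
    \<comment> \<open>The midpoint is \<open>\<tau> / 2 \<le> \<alpha>\<close> away from both
      \<open>z\<close> and \<open>z'\<close>: it lies in the ball contained in
      \<open>\<phi> x\<close> and is close enough to witness a hit of \<open>z'\<close>.\<close>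
    let ?m = "z + (1 / 2) *\<^sub>R (z' - z)"
    have m: "?m - z = (1 / 2) *\<^sub>R (z' - z)" by simp
    have "infnorm (?m - z) \<le> \<alpha>"
      unfolding m using z'(2) alpha_bounds tau infnorm_sub[of z'] by (simp add: infnorm_mul)
    moreover have m': "z' - ?m = (1 / 2) *\<^sub>R (z' - z)" by (simp add: vec_eq_iff field_simps)
    have "infnorm (z' - ?m) \<le> \<alpha>"
      unfolding m' using z'(2) alpha_bounds tau infnorm_sub[of z'] by (simp add: infnorm_mul)
    ultimately have "z' \<in> nbhd \<alpha> (\<phi> x)"
      using sub by (intro nbhdI[of ?m]) (auto simp: mem_max_ball)
    then show False using out x(1) by blast
  qed
  then show ?thesis using layer by blast
qed

text \<open>One grid step displaces the Euler image by at most
  \<open>(1 + L * h) * \<rho> = 2 * \<alpha>\<close>; cancelling the \<alpha>-ball leaves exactly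
  \<alpha>.\<close>

lemma step_hit:
  assumes "infnorm (x' - x) \<le> \<rho>" "max_ball \<alpha> z \<subseteq> \<phi> x'"
  shows "z \<in> nbhd \<alpha> (\<phi> x)"
proof -
  have "\<phi> x' \<subseteq> nbhd (\<alpha> + \<alpha>) (\<phi> x)"
    using euler_lipschitz_le[OF assms(1)] unfolding alpha by (simp add: algebra_simps)
  then show ?thesis
    using assms(2) alpha_bounds rho
    by (intro Radstroem_cancellation[OF compact_euler convex_euler, of \<alpha> \<alpha>]) auto
qed

text \<open>Walk from \<open>x'\<close> towards \<open>x\<close>. While the frontier is out of reach
  of \<open>z'\<close>, the image contains the \<alpha>-ball at \<open>z'\<close>, so by
  \<open>step_hit\<close> the next point hits \<open>z'\<close> too. The walk has at most two steps
  and cannot succeed at \<open>x\<close>, which is in \<open>M\<close>; hence \<open>x'\<close> or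
  the intermediate \<open>m\<close> hits from its frontier.\<close>

lemma boundary1_Phi_frontier:
  assumes "z' \<in> boundary_layer \<tau> 1 (set_image (Phi F \<alpha> h \<tau>) M)"
  shows "\<exists>x\<in>boundary_layer \<rho> 1 M \<union> boundary_layer \<rho> 2 M. z' \<in> nbhd \<alpha> (frontier (\<phi> x))"
proof -
  obtain x z where x: "x \<in> M" "z \<in> nbhd \<alpha> (\<phi> x)" and z': "z' \<in> grid \<tau>" "infnorm (z - z') = \<tau>"
    and out: "\<And>x. x \<in> M \<Longrightarrow> z' \<notin> nbhd \<alpha> (\<phi> x)"
    using assms unfolding boundary_layer_1_iff[OF tau(1) Phi_grid_subset]
    by (auto simp: mem_set_image_Phi)
  obtain x' where x': "x' \<in> grid \<rho>" "z' \<in> nbhd \<alpha> (\<phi> x')" "infnorm (x - x') \<le> 4 / 3 * (\<alpha> + \<tau>) + \<rho> / 2"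
    using hit_neighbour[OF x(2), of z' \<tau>] z'(2) infnorm_sub[of z'] by auto
  have near: "infnorm (x - x') < 3 * \<rho>" using x'(3) alpha_bounds tau rho by argo
  have "x' \<notin> M" using out x'(2) by blast
  then have layer: "x' \<in> boundary_layer \<rho> 1 M \<union> boundary_layer \<rho> 2 M"
    using mem_outer_layers[OF rho M x(1) _ near] x'(1) by blast
  show ?thesis
  proof (cases "z' \<in> nbhd \<alpha> (frontier (\<phi> x'))")
    case False
    then have sub': "max_ball \<alpha> z' \<subseteq> \<phi> x'" using max_ball_subset_if_frontier_far x'(2) by blast
    have "infnorm (x' - x) \<le> real (Suc 1) * \<rho>"
      using grid_infnorm_le[of \<rho> x' x 2] rho x(1) x'(1) M near infnorm_sub[of x'] by auto
    then obtain m where m: "m \<in> grid \<rho>" "infnorm (x' - m) \<le> \<rho>" "infnorm (m - x) \<le> \<rho>"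
      using grid_step_towards[of \<rho> x' x 1] rho x(1) x'(1) M by auto
    have hit: "z' \<in> nbhd \<alpha> (\<phi> m)" using step_hit[OF m(2) sub'] .
    then have "m \<in> grid \<rho> - M" using out m(1) by blast
    then have "m \<in> boundary_layer \<rho> 1 M"
      using boundary_layer_1_iff[OF rho M, of m] boundary0I(2)[OF rho M x(1), of m] m(3) x(1)
        infnorm_sub[of m] rho by auto
    moreover have "z' \<in> nbhd \<alpha> (frontier (\<phi> m))"
      using max_ball_subset_if_frontier_far[OF hit] step_hit[OF m(3)] out x(1) by blast
    ultimately show ?thesis by blast
  qed (use layer in blast)
qed

text \<open>Layer 0 is at most \<open>2 * \<rho>\<close> away from \<open>x'\<close>, so frontiers
  are transferred at a cost just above \<open>4 * \<alpha>\<close>. The plain hit comes from the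
  crossing argument; the two witnesses may differ, in keeping with the intersection that forms
  \<open>W00\<close>.\<close>

lemma outer_frontier_hit_from_boundary0:
  assumes "x' \<in> boundary_layer \<rho> 1 M \<union> boundary_layer \<rho> 2 M" "z \<in> nbhd \<alpha> (frontier (\<phi> x'))"
    and "x \<in> M" "z \<in> nbhd \<alpha> (\<phi> x)"
    and "4 * \<alpha> < k"
  shows "\<exists>x\<in>boundary0 \<rho> M. z \<in> nbhd (\<alpha> + k) (frontier (\<phi> x))" "\<exists>x\<in>boundary0 \<rho> M. z \<in> nbhd \<alpha> (\<phi> x)"
proof -
  have "x' \<in> grid \<rho> - M" using assms(1) by (auto simp: boundary_layer_def)
  moreover have "z \<in> nbhd \<alpha> (\<phi> x')"
    using assms(2) nbhd_mono[OF order_refl frontier_euler_subset] by blast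
  ultimately show "\<exists>x\<in>boundary0 \<rho> M. z \<in> nbhd \<alpha> (\<phi> x)"
    using hit_from_boundary_if_hits_cross assms(3,4) by blast
  obtain x0 where x0: "x0 \<in> boundary0 \<rho> M" "infnorm (x0 - x') \<le> 2 * \<rho>"
    using outer_layer_near_boundary0[OF rho M assms(1)] .
  have eq: "(1 + L * h) * (2 * \<rho>) = 4 * \<alpha>" by (simp add: alpha)
  have "nbhd \<alpha> (frontier (\<phi> x')) \<subseteq> nbhd (\<alpha> + k) (frontier (\<phi> x0))"
    using euler_lipschitz_le[of x' x0 "2 * \<rho>"] euler_lipschitz_le[OF x0(2)] x0(2) infnorm_sub[of x']
      alpha_bounds rho assms(5)
    unfolding eq by (intro nbhd_frontier_transfer[OF compact_euler convex_euler, of _ "4 * \<alpha>"]) auto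
  then show "\<exists>x\<in>boundary0 \<rho> M. z \<in> nbhd (\<alpha> + k) (frontier (\<phi> x))" using assms(2) x0(1) by blast
qed

lemma tr_Phi:
  assumes "4 * \<alpha> < k"
  defines "D0 \<equiv> boundary0 \<rho> M"
  defines "W0 \<equiv> (set_image (Phi_bd F (\<alpha> + k) h \<tau>) D0 \<inter> set_image (Phi F \<alpha> h \<tau>) D0) \<union>
    set_image (Phi_bd F \<alpha> h \<tau>) (boundary_layer \<rho> (-1) M)"
  defines "W1 \<equiv> set_image (Phi_bd F \<alpha> h \<tau>) (boundary_layer \<rho> 1 M \<union> boundary_layer \<rho> 2 M)"
  defines "E1 \<equiv> {x \<in> W1. max_dist x W0 = ereal \<tau>}"
  defines "E0 \<equiv> {x \<in> W0. max_dist x E1 = ereal \<tau>}"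
  shows "(E0, E1) = tr \<tau> (set_image (Phi F \<alpha> h \<tau>) M)"
  unfolding E0_def E1_def
proof (rule tr_eqI[OF tau(1) Phi_grid_subset])
  have frontier: "z \<in> nbhd \<alpha> (\<phi> x)" if "z \<in> nbhd \<alpha> (frontier (\<phi> x))" for z x
    using that nbhd_mono[OF order_refl frontier_euler_subset] by blast
  have inner: "D0 \<subseteq> M" "boundary_layer \<rho> (-1) M \<subseteq> M"
    by (auto simp: D0_def boundary0_def boundary_layer_def)
  show "W0 \<subseteq> set_image (Phi F \<alpha> h \<tau>) M"
    unfolding W0_def subset_iff Un_iff Int_iff mem_set_image_Phi mem_set_image_Phi_bd
    using frontier inner by blast
  show "W1 \<subseteq> grid \<tau>"
    unfolding W1_def by (auto simp: mem_set_image_Phi_bd)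
  show "W1 \<inter> set_image (Phi F \<alpha> h \<tau>) M \<subseteq> W0"
  proof
    fix z assume "z \<in> W1 \<inter> set_image (Phi F \<alpha> h \<tau>) M"
    then obtain x' x where *: "x' \<in> boundary_layer \<rho> 1 M \<union> boundary_layer \<rho> 2 M"
      "z \<in> nbhd \<alpha> (frontier (\<phi> x'))" "x \<in> M" "z \<in> nbhd \<alpha> (\<phi> x)" and "z \<in> grid \<tau>"
      unfolding W1_def mem_set_image_Phi mem_set_image_Phi_bd Int_iff by blast
    then show "z \<in> W0"
      using outer_frontier_hit_from_boundary0[OF * assms(1)]
      unfolding W0_def D0_def by (simp add: mem_set_image_Phi mem_set_image_Phi_bd)
  qed
  show "boundary0 \<tau> (set_image (Phi F \<alpha> h \<tau>) M) \<subseteq> W0"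
  proof
    fix z assume z: "z \<in> boundary0 \<tau> (set_image (Phi F \<alpha> h \<tau>) M)"
    then have "z \<in> grid \<tau>" using boundary0_subset_grid[OF Phi_grid_subset] by blast
    \<comment> \<open>A frontier hit from layer 0 within \<alpha> has to enter both sets of the
      intersection: the radius grows to \<open>\<alpha> + k\<close> for one, and the frontier lies
      in the image for the other.\<close>
    moreover have "nbhd \<alpha> (frontier (\<phi> x)) \<subseteq> nbhd (\<alpha> + k) (frontier (\<phi> x))" for x
      using assms(1) alpha_bounds rho by (intro nbhd_mono) auto
    ultimately show "z \<in> W0"
      using boundary0_Phi_frontier[OF z] frontier
      unfolding W0_def D0_def Un_iff Int_iff mem_set_image_Phi mem_set_image_Phi_bd by blast
  qed
  show "boundary_layer \<tau> 1 (set_image (Phi F \<alpha> h \<tau>) M) \<subseteq> W1"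
  proof
    fix z assume z: "z \<in> boundary_layer \<tau> 1 (set_image (Phi F \<alpha> h \<tau>) M)"
    then have "z \<in> grid \<tau>" by (auto simp: boundary_layer_def)
    then show "z \<in> W1"
      using boundary1_Phi_frontier[OF z] unfolding W1_def mem_set_image_Phi_bd by blast
  qed
qed

text \<open>Rounding any point of \<open>\<phi> x\<close> to the grid of width \<tau> costs at most
  \<open>\<tau> / 2\<close>, which \<alpha> covers.\<close>

lemma Phi_in_grid_sets:
  assumes "M \<noteq> {}"
  shows "set_image (Phi F \<alpha> h \<tau>) M \<in> grid_sets \<tau>"
proof -
  obtain x f where "x \<in> M" "f \<in> F x" using assms F_ne by blast
  moreover obtain z where "z \<in> grid \<tau>" "infnorm (z - (x + h *\<^sub>R f)) \<le> \<tau> / 2"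
    using grid_nearest[OF tau(1)] .
  ultimately have "z \<in> set_image (Phi F \<alpha> h \<tau>) M"
    unfolding mem_set_image_Phi using alpha_bounds tau
    by (auto intro!: bexI[of _ x] nbhdI[of "x + h *\<^sub>R f"] simp: euler_def)
  then show ?thesis using Phi_grid_subset by (auto simp: grid_sets_def)
qed

end

end

theorem theorem4p8:
  fixes F :: "real ^ 'd \<Rightarrow> (real ^ 'd) set"
    and L P h \<rho> \<rho>' \<rho>t \<alpha> \<kappa> :: real
    and D0 D1 Dm1 D2 W00 W1 W0m1 Dt0 Dt1 :: "(real ^ 'd) set"
  assumes "L > 0" and "P > 0"
    and "\<And>x. F x \<noteq> {} \<and> compact (F x) \<and> convex (F x)"
    and "\<And>x y. max_hausdorff (F x) (F y) \<le> ereal (L * infnorm (x - y))"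
    and "\<And>x f. f \<in> F x \<Longrightarrow> infnorm f \<le> P"
    and "0 < h" and "h \<le> 1 / (4 * L)"
    and "\<rho> > 0" and "\<rho>' > 0"
    and "\<rho>' / \<rho> \<in> {0<..<1} \<union> real ` {1..}"
    and "\<alpha> = (1 + L * h) * (\<rho> / 2)"
    and "\<kappa> = 2 * (1 + L * h) * (\<alpha> / (1 - L * h) + \<rho>)"
    and "\<rho>t = min \<rho> \<rho>'"
    and "(D0, D1) \<in> bdc \<rho>"
    and "Dm1 = boundary_layer \<rho> (-1) (tr_inv \<rho> (D0, D1))"
    and "D2 = boundary_layer \<rho> 2 (tr_inv \<rho> (D0, D1))"
    and "W00 = set_image (Phi_bd F (\<alpha> + \<kappa>) h \<rho>t) D0 \<inter> set_image (Phi F \<alpha> h \<rho>t) D0"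
    and "W1 = set_image (Phi_bd F \<alpha> h \<rho>t) (D1 \<union> D2)"
    and "W0m1 = set_image (Phi_bd F \<alpha> h \<rho>t) Dm1"
    and "Dt1 = {x \<in> W1. max_dist x (W00 \<union> W0m1) = ereal \<rho>t}"
    and "Dt0 = {x \<in> W00 \<union> W0m1. max_dist x Dt1 = ereal \<rho>t}"
  shows "(\<rho>' > \<rho> \<longrightarrow> (Dt0, Dt1) \<in> bd \<rho>t) \<and>
    Psi F L h \<rho> \<rho>' (D0, D1) =
      (if \<rho>' \<le> \<rho> then (Dt0, Dt1) else bd_regrid \<rho>t \<rho>' (Dt0, Dt1))"
proof -
  have Lh: "L * h \<le> 1 / 4" using assms(1,7) by (simp add: field_simps)
  interpret lipschitz_inclusion F L P h
    by unfold_locales (use assms Lh in auto)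
  define M where "M = tr_inv \<rho> (D0, D1)"
  \<comment> \<open>\<open>tr_inv\<close> only chooses a preimage; membership in the range of
    \<open>tr \<rho>\<close> makes \<open>M\<close> a genuine one, with layers \<open>D0\<close> and
    \<open>D1\<close>.\<close>
  have "(D0, D1) \<in> tr \<rho> ` grid_sets \<rho>"
    using assms(14) by (auto simp: bdc_def chain_connected_sets_def)
  then have M: "M \<in> grid_sets \<rho>" and tr_M: "tr \<rho> M = (D0, D1)"
    unfolding M_def tr_inv_def by (rule inv_into_into, rule f_inv_into_f)
  then have sub: "M \<subseteq> grid \<rho>" and ne: "M \<noteq> {}"
    and D: "D0 = boundary0 \<rho> M" "D1 = boundary_layer \<rho> 1 M"
    by (auto simp: grid_sets_def tr_def boundary_layer_def)
  have t: "0 < \<rho>t" "\<rho>t \<le> \<rho>" using assms by auto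
  have "0 < \<alpha>" using assms(1,6,8) unfolding assms(11) by (intro mult_pos_pos add_pos_pos) auto
  have "4 * \<alpha> = 2 * (1 + L * h) * \<rho>" unfolding assms(11) by simp
  \<comment> \<open>\<kappa> exceeds this by the term with \<open>\<alpha> / (1 - L * h)\<close>,
    positive since \<open>L * h \<le> 1 / 4\<close>.\<close>
  also have "\<dots> < \<kappa>"
    unfolding assms(12) using \<open>0 < \<alpha>\<close> Lh assms(1,6)
    by (intro mult_strict_left_mono) (auto simp: add_pos_pos)
  finally have "4 * \<alpha> < \<kappa>" .
  from tr_Phi[OF assms(8) t assms(11) sub this]
  have tr: "(Dt0, Dt1) = tr \<rho>t (set_image (Phi F \<alpha> h \<rho>t) M)"
    unfolding assms(15-21) unfolding M_def[symmetric] unfolding D .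
  have mem: "set_image (Phi F \<alpha> h \<rho>t) M \<in> grid_sets \<rho>t"
    using Phi_in_grid_sets[OF assms(8) t assms(11) sub ne] .
  have Psi: "Psi F L h \<rho> \<rho>' (D0, D1) = tr \<rho>' (set_image (Phi_regrid F \<alpha> h \<rho> \<rho>') M)"
    by (simp add: Psi_def M_def blow_up_def assms(11))
  show ?thesis
  proof (cases "\<rho>' \<le> \<rho>")
    case True
    then have "Phi_regrid F \<alpha> h \<rho> \<rho>' = Phi F \<alpha> h \<rho>t"
      using assms(13) by (auto simp: Phi_regrid_def)
    then show ?thesis using True assms(13) by (simp add: Psi tr)
  next
    case False
    then have "Phi_regrid F \<alpha> h \<rho> \<rho>' = (\<lambda>x. regrid \<rho>' (Phi F \<alpha> h \<rho>t x))"
      using assms(13) by (auto simp: Phi_regrid_def)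
    \<comment> \<open>Regridding is a union over points, so it commutes with the union over
      \<open>M\<close>.\<close>
    then have "Psi F L h \<rho> \<rho>' (D0, D1) = tr \<rho>' (regrid \<rho>' (set_image (Phi F \<alpha> h \<rho>t) M))"
      by (simp add: Psi set_image_regrid)
    \<comment> \<open>By injectivity of \<open>tr \<rho>t\<close>, its inverse applied to
      \<open>(Dt0, Dt1)\<close> returns the Euler image itself.\<close>
    also have "\<dots> = bd_regrid \<rho>t \<rho>' (Dt0, Dt1)"
      by (simp add: bd_regrid_def tr tr_inv_def inv_into_f_f[OF inj_on_tr[OF t(1)] mem])
    finally show ?thesis using False mem by (auto simp: bd_def tr)
  qed
qed

end
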